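(* Let $d\in\mathbb{N}$, let $T_1,\dots,T_N:\mathbb{R}^d\to\mathbb{R}^d$ be linear contracting similarities with $\mathrm{Lip}(T_i)<1/2$ for all $i$, and let $C\subset\mathbb{R}^d$ be a non-empty compact set. For $\mathbf{t}=(t_1,\dots,t_N)\in(\mathbb{R}^d)^N$, let $F_{\mathbf{t},\emptyset}$ be the unique non-empty compact set satisfying $$F_{\mathbf{t},\emptyset}=\bigcup_{i=1}^N\big(T_i(F_{\mathbf{t},\emptyset})+t_i\big)$$ and let $F_{\mathbf{t},C}$ be the unique non-empty compact set satisfying $$F_{\mathbf{t},C}=\bigcup_{i=1}^N\big(T_i(F_{\mathbf{t},C})+t_i\big)\cup C.$$ Then $$\overline{\dim}_{\mathrm B}F_{\mathbf{t},C}=\max\{\overline{\dim}_{\mathrm B}F_{\mathbf{t},\emptyset},\ \overline{\dim}_{\mathrm B}C\}$$ for $\mathcal{L}^{dN}$-almost all $\mathbf{t}\in(\mathbb{R}^d)^N$, where $\mathcal{L}^{dN}$ is the $N$-fold product of $d$-dimensional Lebesgue measure.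
   Context: A linear contracting similarity $T_i$ is a linear map with $|T_i(x)-T_i(y)|=\mathrm{Lip}(T_i)\,|x-y|$ for all $x,y\in\mathbb{R}^d$, where $\mathrm{Lip}(T_i)\in(0,1)$ is constant. For a non-empty bounded set $E\subset\mathbb{R}^d$ and $\delta>0$, $N_\delta(E)$ is the minimum number of sets of diameter at most $\delta$ required to cover $E$, and $\overline{\dim}_{\mathrm B}E=\limsup_{\delta\to0}\frac{\log N_\delta(E)}{-\log\delta}$. *)

theory Defs
  imports "HOL-Analysis.Analysis"
begin

text \<open>The second argument \<open>r\<close> is the constant \<open>Lip(T)\<close>; on a space with more than one point
  it is determined by \<open>T\<close>.\<close>

definition linear_contracting_similarity :: "('a::euclidean_space \<Rightarrow> 'a) \<Rightarrow> real \<Rightarrow> bool"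
  where "linear_contracting_similarity T r \<longleftrightarrow>
    linear T \<and> 0 < r \<and> r < 1 \<and> (\<forall>x y. dist (T x) (T y) = r * dist x y)"

text \<open>Boundedness is required explicitly because \<^const>\<open>diameter\<close> is unspecified
  on unbounded sets.\<close>

definition covering_number :: "real \<Rightarrow> 'a::metric_space set \<Rightarrow> nat"
  where "covering_number \<delta> E = (LEAST n. \<exists>\<U>. finite \<U> \<and> card \<U> = n \<and> E \<subseteq> \<Union>\<U> \<and>
    (\<forall>U\<in>\<U>. bounded U \<and> diameter U \<le> \<delta>))"

definition upper_box_dim :: "'a::metric_space set \<Rightarrow> ereal"
  where "upper_box_dim E =
    Limsup (at_right 0) (\<lambda>\<delta>. ereal (ln (real (covering_number \<delta> E)) / (- ln \<delta>)))"

text \<open>For contractions \<open>T i\<close>, \<open>N \<ge> 1\<close> and compact \<open>C\<close> (possibly empty) there is exactly one such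
  set, by Hutchinson's theorem. The case \<open>C = {}\<close> is the homogeneous attractor.\<close>

definition attractor ::
    "nat \<Rightarrow> (nat \<Rightarrow> 'a \<Rightarrow> 'a) \<Rightarrow> (nat \<Rightarrow> 'a) \<Rightarrow> 'a set \<Rightarrow> 'a::euclidean_space set"
  where "attractor N T t C = (THE F. F \<noteq> {} \<and> compact F \<and>
    F = (\<Union>i\<in>{1..N}. (\<lambda>x. T i x + t i) ` F) \<union> C)"

end

theory Submission
  imports Defs "HOL-Real_Asymp.Real_Asymp"
begin

text \<open>Write \<open>F\<^sub>C\<close> for the attractor with condensation set \<open>C\<close> and \<open>F\<close> for the attractor with
  \<open>C = {}\<close>, let \<open>d\<close> be the dimension of the space, and let \<open>s\<close> be the similarity dimension, the solution of
  \<open>(\<Sum>i. (Lip i)\<^bsup>s\<^esup>) = 1\<close>. Since \<open>F\<close> and \<open>C\<close> are subsets of \<open>F\<^sub>C\<close>, one inequality is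
  monotonicity of the dimension. For the other one, two facts are combined.

  For every parameter, the dimension of \<open>F\<^sub>C\<close> is at most \<open>max s (dim C)\<close>
  (\<open>upper_box_dim_attractor_le\<close>): covering \<open>F\<^sub>C\<close> at scale \<open>\<delta>\<close> reduces to covering \<open>F\<^sub>C\<close> at the
  larger scales \<open>\<delta> / Lip i\<close> and \<open>C\<close> at scale \<open>\<delta>\<close>. It is also at most \<open>d\<close>
  (\<open>upper_box_dim_le_DIM\<close>).

  For almost every parameter, the dimension of \<open>F\<close> is at least \<open>min s d\<close>
  (\<open>AE_le_upper_box_dim_attractor\<close>). Hence if \<open>s \<le> d\<close>, then \<open>F\<close> accounts for the term \<open>s\<close> in the
  upper bound, and if \<open>s > d\<close>, then \<open>F\<close> already has the largest possible dimension.

  The almost sure lower bound is a potential-theoretic argument at finite scales. Give the word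
  \<open>I = i\<^sub>1 \<dots> i\<^sub>n\<close> the weight \<open>(Lip i\<^sub>1 \<cdots> Lip i\<^sub>n)\<^bsup>s\<^esup>\<close>, and let the energy be the
  total weight of the pairs \<open>(I, J)\<close> of words of length \<open>n\<close> whose maps send \<open>0\<close> to points at distance
  \<open>O(rmax\<^bsup>n\<^esup>)\<close>, where \<open>rmax\<close> is the largest of the ratios. By the Cauchy-Schwarz inequality the covering number
  of \<open>F\<close> at scale \<open>rmax\<^bsup>n\<^esup>\<close> is at least the reciprocal of the energy
  (\<open>one_le_covering_number_mult_energy\<close>). By Markov's inequality and the Borel-Cantelli lemma it
  is therefore enough to bound the energy integrated over a bounded set of parameters
  (\<open>expected_energy_le\<close>).

  That bound is obtained by induction on \<open>n\<close>. Two words with the same first letter \<open>i\<close> are compared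
  after removal of this letter, at scale \<open>\<rho> / Lip i\<close>. For two words with different first letters \<open>i\<close>
  and \<open>j\<close> the condition \<open>Lip < 1 / 2\<close> enters: the difference of the two points is an expanding
  function of the translation \<open>t i\<close> or of \<open>t j\<close> (\<open>word_map_difference_expanding\<close>), so that by
  Fubini's theorem the set of parameters for which the points are \<open>\<rho>\<close>-close has measure
  \<open>O(\<rho>\<^bsup>d\<^esup>)\<close> (\<open>measure_close_params_le\<close>).\<close>

section \<open>Covering numbers\<close>

definition covers :: "real \<Rightarrow> 'a::metric_space set \<Rightarrow> 'a set set \<Rightarrow> bool"
  where "covers \<delta> E \<U> \<longleftrightarrow> finite \<U> \<and> E \<subseteq> \<Union>\<U> \<and> (\<forall>U\<in>\<U>. bounded U \<and> diameter U \<le> \<delta>)"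

lemma covering_number_le_card: "covers \<delta> E \<U> \<Longrightarrow> covering_number \<delta> E \<le> card \<U>"
  unfolding covering_number_def covers_def by (intro Least_le exI[of _ \<U>]) auto

lemma bounded_finite_cover_exists:
  fixes E :: "'a::euclidean_space set"
  assumes "bounded E" "\<delta> > 0"
  shows "\<exists>\<U>. covers \<delta> E \<U>"
proof -
  have "compact (closure E)" using assms(1) by (simp add: compact_closure)
  then obtain k where k: "finite k" "closure E \<subseteq> (\<Union>x\<in>k. ball x (\<delta>/2))"
    using \<open>\<delta> > 0\<close> compact_eq_totally_bounded[of "closure E"] by (meson half_gt_zero)
  have "diameter (ball x (\<delta>/2)) \<le> \<delta>" for x :: 'a
    using \<open>\<delta> > 0\<close> by simp
  then have "covers \<delta> E ((\<lambda>x. ball x (\<delta>/2)) ` k)"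
    unfolding covers_def using k closure_subset[of E] by auto
  then show ?thesis ..
qed

lemma covering_number_attained:
  fixes E :: "'a::euclidean_space set"
  assumes "bounded E" "\<delta> > 0"
  obtains \<U> where "covers \<delta> E \<U>" "card \<U> = covering_number \<delta> E"
proof -
  have "\<exists>n \<U>. finite \<U> \<and> card \<U> = n \<and> E \<subseteq> \<Union>\<U> \<and> (\<forall>U\<in>\<U>. bounded U \<and> diameter U \<le> \<delta>)"
    using bounded_finite_cover_exists[OF assms] unfolding covers_def by blast
  from LeastI_ex[OF this] show ?thesis
    using that unfolding covering_number_def covers_def by blast
qed

lemma covering_number_mono:
  fixes E E' :: "'a::euclidean_space set"
  assumes "bounded E'" "E \<subseteq> E'" "0 < \<delta>'" "\<delta>' \<le> \<delta>"
  shows "covering_number \<delta> E \<le> covering_number \<delta>' E'"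
proof -
  obtain \<U> where "covers \<delta>' E' \<U>" and card: "card \<U> = covering_number \<delta>' E'"
    using covering_number_attained assms by metis
  then have "covers \<delta> E \<U>" using assms unfolding covers_def by force
  then show ?thesis using covering_number_le_card card by metis
qed

lemma covering_number_Un:
  fixes E E' :: "'a::euclidean_space set"
  assumes "bounded E" "bounded E'" "0 < \<delta>"
  shows "covering_number \<delta> (E \<union> E') \<le> covering_number \<delta> E + covering_number \<delta> E'"
proof -
  obtain \<U> where U: "covers \<delta> E \<U>" "card \<U> = covering_number \<delta> E"
    using covering_number_attained assms by metis
  obtain \<V> where V: "covers \<delta> E' \<V>" "card \<V> = covering_number \<delta> E'"
    using covering_number_attained assms by metis
  have "covers \<delta> (E \<union> E') (\<U> \<union> \<V>)" using U V unfolding covers_def by auto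
  then show ?thesis
    using covering_number_le_card card_Un_le[of \<U> \<V>] U V by (metis le_trans)
qed

lemma covering_number_UN:
  fixes E :: "'i \<Rightarrow> 'a::euclidean_space set"
  assumes "finite I" "\<And>i. i \<in> I \<Longrightarrow> bounded (E i)" "0 < \<delta>"
  shows "covering_number \<delta> (\<Union>i\<in>I. E i) \<le> (\<Sum>i\<in>I. covering_number \<delta> (E i))"
  using assms(1,2)
proof (induction I rule: finite_induct)
  case empty
  have "covers \<delta> ({} :: 'a set) {}" by (simp add: covers_def)
  from covering_number_le_card[OF this] show ?case by simp
next
  case (insert i I)
  have "covering_number \<delta> (E i \<union> (\<Union>i\<in>I. E i))
      \<le> covering_number \<delta> (E i) + covering_number \<delta> (\<Union>i\<in>I. E i)"
    using insert by (intro covering_number_Un bounded_UN assms(3)) auto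
  also have "covering_number \<delta> (\<Union>i\<in>I. E i) \<le> (\<Sum>i\<in>I. covering_number \<delta> (E i))"
    using insert by simp
  finally show ?case using insert by simp
qed

lemma covering_number_similarity_image:
  fixes f :: "'a::euclidean_space \<Rightarrow> 'a"
  assumes f: "\<And>x y. dist (f x) (f y) = r * dist x y" and "r > 0" "bounded E" "\<delta> > 0"
  shows "covering_number \<delta> (f ` E) \<le> covering_number (\<delta> / r) E"
proof -
  obtain \<U> where U: "covers (\<delta> / r) E \<U>" "card \<U> = covering_number (\<delta> / r) E"
    using covering_number_attained assms by (metis divide_pos_pos)
  have bdd: "bounded (f ` U)" and diam: "diameter (f ` U) \<le> \<delta>" if "U \<in> \<U>" for U
  proof -
    have "bounded U" "diameter U \<le> \<delta> / r" using U that by (auto simp: covers_def)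
    then have "dist x y \<le> \<delta> / r" if "x \<in> U" "y \<in> U" for x y
      using diameter_bounded_bound[of U x y] that by auto
    then have *: "dist (f x) (f y) \<le> \<delta>" if "x \<in> U" "y \<in> U" for x y
      using that f[of x y] \<open>r > 0\<close> by (simp add: pos_le_divide_eq mult.commute)
    show "bounded (f ` U)"
      using * unfolding bounded_two_points by blast
    show "diameter (f ` U) \<le> \<delta>"
      using * \<open>\<delta> > 0\<close> by (intro diameter_le) (auto simp: dist_norm)
  qed
  have "covers \<delta> (f ` E) ((`) f ` \<U>)"
    unfolding covers_def
  proof (intro conjI ballI)
    show "finite ((`) f ` \<U>)" using U(1) by (simp add: covers_def)
    show "f ` E \<subseteq> \<Union> ((`) f ` \<U>)" using U(1) unfolding covers_def by blast
  qed (use bdd diam in auto)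
  then have "covering_number \<delta> (f ` E) \<le> card ((`) f ` \<U>)" by (rule covering_number_le_card)
  also have "\<dots> \<le> card \<U>" using U(1) by (intro card_image_le) (simp add: covers_def)
  finally show ?thesis using U(2) by simp
qed

lemma covering_number_pos:
  fixes E :: "'a::euclidean_space set"
  assumes "bounded E" "\<delta> > 0" "E \<noteq> {}"
  shows "covering_number \<delta> E \<ge> 1"
proof -
  obtain \<U> where U: "covers \<delta> E \<U>" "card \<U> = covering_number \<delta> E"
    using covering_number_attained assms by metis
  then have "finite \<U>" "\<U> \<noteq> {}" using \<open>E \<noteq> {}\<close> by (auto simp: covers_def)
  then show ?thesis using U(2) card_gt_0_iff[of \<U>] by simp
qed

section \<open>Upper box dimension\<close>

lemma eventually_at_right_0_less: "c > 0 \<Longrightarrow> \<forall>\<^sub>F \<delta> in at_right (0::real). 0 < \<delta> \<and> \<delta> < c"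
  by (auto simp: eventually_at_right_field)

lemma upper_box_dim_mono:
  fixes E E' :: "'a::euclidean_space set"
  assumes "bounded E'" "E \<subseteq> E'" "E \<noteq> {}"
  shows "upper_box_dim E \<le> upper_box_dim E'"
  unfolding upper_box_dim_def
proof (rule Limsup_mono)
  show "\<forall>\<^sub>F \<delta> in at_right 0. ereal (ln (real (covering_number \<delta> E)) / - ln \<delta>)
      \<le> ereal (ln (real (covering_number \<delta> E')) / - ln \<delta>)"
    using eventually_at_right_0_less[of 1, OF zero_less_one]
  proof eventually_elim
    case (elim \<delta>)
    have "1 \<le> covering_number \<delta> E" "covering_number \<delta> E \<le> covering_number \<delta> E'"
      using covering_number_pos[of E \<delta>] covering_number_mono[of E' E \<delta> \<delta>] assms elim
        bounded_subset by auto
    then have "ln (real (covering_number \<delta> E)) \<le> ln (real (covering_number \<delta> E'))" by simp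
    moreover have "- ln \<delta> > 0" using elim by simp
    ultimately show ?case by (simp add: divide_right_mono divide_right_mono_neg)
  qed
qed

lemma upper_box_dim_leI:
  fixes E :: "'a::euclidean_space set"
  assumes "bounded E" "E \<noteq> {}" "M > 0"
    and ev: "\<forall>\<^sub>F \<delta> in at_right 0. real (covering_number \<delta> E) \<le> M * \<delta> powr (- s)"
  shows "upper_box_dim E \<le> ereal s"
proof -
  have "((\<lambda>\<delta>. ln M / - ln \<delta> + s) \<longlongrightarrow> s) (at_right 0)"
    by real_asymp
  then have lim: "((\<lambda>\<delta>. ereal (ln M / - ln \<delta> + s)) \<longlongrightarrow> ereal s) (at_right 0)"
    by simp
  have "upper_box_dim E \<le> Limsup (at_right 0) (\<lambda>\<delta>. ereal (ln M / - ln \<delta> + s))"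
    unfolding upper_box_dim_def
  proof (rule Limsup_mono)
    show "\<forall>\<^sub>F \<delta> in at_right 0. ereal (ln (real (covering_number \<delta> E)) / - ln \<delta>)
      \<le> ereal (ln M / - ln \<delta> + s)"
      using eventually_at_right_0_less[of 1, OF zero_less_one] ev
    proof eventually_elim
      case (elim \<delta>)
      have "1 \<le> covering_number \<delta> E"
        using covering_number_pos[of E \<delta>] assms elim by auto
      then have "ln (real (covering_number \<delta> E)) \<le> ln (M * \<delta> powr (- s))"
        using elim by (intro ln_mono) auto
      also have "\<dots> = ln M + s * (- ln \<delta>)"
        using \<open>M > 0\<close> elim by (simp add: ln_mult ln_powr)
      finally show ?case using elim by (simp add: field_simps)
    qed
  qed
  also have "\<dots> = ereal s"
    by (rule lim_imp_Limsup[OF _ lim]) simp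
  finally show ?thesis .
qed

lemma covering_number_le_of_upper_box_dim_less:
  fixes E :: "'a::euclidean_space set"
  assumes "bounded E" "E \<noteq> {}" "upper_box_dim E < ereal s"
  shows "\<forall>\<^sub>F \<delta> in at_right 0. real (covering_number \<delta> E) \<le> \<delta> powr (- s)"
proof -
  have "\<forall>\<^sub>F \<delta> in at_right 0. ereal (ln (real (covering_number \<delta> E)) / - ln \<delta>) < ereal s"
    using assms(3) unfolding upper_box_dim_def by (rule Limsup_lessD)
  then show ?thesis using eventually_at_right_0_less[of 1, OF zero_less_one]
  proof eventually_elim
    case (elim \<delta>)
    have pos: "1 \<le> covering_number \<delta> E"
      using covering_number_pos[of E \<delta>] assms elim by auto
    have "- ln \<delta> > 0" using elim by simp
    then have "ln (real (covering_number \<delta> E)) \<le> s * (- ln \<delta>)"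
      using elim by (simp add: field_simps)
    then have "exp (ln (real (covering_number \<delta> E))) \<le> exp (s * (- ln \<delta>))" by simp
    then show ?case using pos elim by (simp add: powr_def)
  qed
qed

lemma Limsup_filter_mono: "F \<le> G \<Longrightarrow> Limsup F f \<le> Limsup G f"
  for f :: "'a \<Rightarrow> 'b::complete_lattice"
  unfolding Limsup_def by (intro INF_superset_mono) (auto simp: le_filter_def)

text \<open>For a lower bound on the upper dimension it suffices to look at one sequence of scales.\<close>

lemma le_upper_box_dimI:
  fixes E :: "'a::euclidean_space set" and \<delta> :: "nat \<Rightarrow> real"
  assumes "\<And>n. \<delta> n > 0" "\<delta> \<longlonglongrightarrow> 0"
    and "(\<lambda>n. g n) \<longlonglongrightarrow> m"
    and "\<forall>\<^sub>F n in sequentially. g n \<le> ln (real (covering_number (\<delta> n) E)) / - ln (\<delta> n)"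
  shows "ereal m \<le> upper_box_dim E"
proof -
  let ?f = "\<lambda>\<delta>. ereal (ln (real (covering_number \<delta> E)) / - ln \<delta>)"
  have "filterlim \<delta> (at_right 0) sequentially"
    using assms(1,2) by (auto simp: filterlim_at intro!: always_eventually less_imp_neq[symmetric])
  then have "Limsup sequentially (\<lambda>n. ?f (\<delta> n)) \<le> Limsup (at_right 0) ?f"


    unfolding filterlim_def
    by (intro order_trans[OF Limsup_filtermap_ge[where g = ?f] Limsup_filter_mono])
  moreover have "ereal m = Limsup sequentially (\<lambda>n. ereal (g n))"
    using assms(3) by (intro lim_imp_Limsup[symmetric]) auto
  moreover have "Limsup sequentially (\<lambda>n. ereal (g n)) \<le> Limsup sequentially (\<lambda>n. ?f (\<delta> n))"
    using assms(4) by (intro Limsup_mono) auto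
  ultimately show ?thesis unfolding upper_box_dim_def by simp
qed

text \<open>A grid of mesh \<open>\<delta> / DIM('a)\<close> covers a bounded set by \<open>O(\<delta>\<^bsup>-DIM('a)\<^esup>)\<close> cells.\<close>

lemma upper_box_dim_le_DIM:
  fixes E :: "'a::euclidean_space set"
  assumes "bounded E" "E \<noteq> {}"
  shows "upper_box_dim E \<le> ereal (DIM('a))"
proof -
  let ?d = "real DIM('a)"
  obtain R where R: "R > 0" "\<And>x. x \<in> E \<Longrightarrow> norm x \<le> R"
    using assms(1) bounded_pos by metis
  have bound: "real (covering_number \<delta> E) \<le> (2 * R * ?d + 5) ^ DIM('a) * \<delta> powr (- ?d)"
    if \<delta>: "0 < \<delta>" "\<delta> < 1" for \<delta>
  proof -
    define \<epsilon> where "\<epsilon> = \<delta> / ?d"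
    have \<epsilon>: "\<epsilon> > 0" using \<delta> by (simp add: \<epsilon>_def)
    define K where "K = \<lfloor>R / \<epsilon>\<rfloor> + 1"
    define cell where "cell x = (\<lambda>b\<in>(Basis::'a set). \<lfloor>(x \<bullet> b) / \<epsilon>\<rfloor>)" for x
    define G where "G = PiE (Basis::'a set) (\<lambda>_. {-K..K})"
    define \<U> where "\<U> = (\<lambda>c. E \<inter> {x. cell x = c}) ` G"
    have inG: "cell x \<in> G" if "x \<in> E" for x
    proof -
      have "- K \<le> \<lfloor>(x \<bullet> b) / \<epsilon>\<rfloor> \<and> \<lfloor>(x \<bullet> b) / \<epsilon>\<rfloor> \<le> K" if b: "b \<in> Basis" for b
      proof -
        have "\<bar>x \<bullet> b\<bar> \<le> R" using Basis_le_norm[OF b, of x] R(2)[OF \<open>x \<in> E\<close>] by linarith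
        then have "\<bar>(x \<bullet> b) / \<epsilon>\<bar> \<le> R / \<epsilon>" using \<epsilon> by (simp add: divide_right_mono)
        then show ?thesis unfolding K_def by linarith
      qed
      then show ?thesis by (auto simp: cell_def G_def)
    qed
    have near: "dist x y \<le> \<delta>" if "cell x = cell y" for x y
    proof -
      have "\<bar>(x - y) \<bullet> b\<bar> \<le> \<epsilon>" if b: "b \<in> Basis" for b
      proof -
        have "\<lfloor>(x \<bullet> b) / \<epsilon>\<rfloor> = \<lfloor>(y \<bullet> b) / \<epsilon>\<rfloor>"
          using fun_cong[OF \<open>cell x = cell y\<close>, of b] b by (simp add: cell_def)
        then have "\<bar>(x \<bullet> b) / \<epsilon> - (y \<bullet> b) / \<epsilon>\<bar> \<le> 1" by linarith
        then have "\<bar>((x - y) \<bullet> b) / \<epsilon>\<bar> \<le> 1" by (simp add: inner_diff_left diff_divide_distrib)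
        then show ?thesis using \<epsilon> by simp
      qed
      then have "(\<Sum>b\<in>Basis. \<bar>(x - y) \<bullet> b\<bar>) \<le> ?d * \<epsilon>"
        using sum_bounded_above[of "Basis::'a set" "\<lambda>b. \<bar>(x - y) \<bullet> b\<bar>" \<epsilon>] by simp
      then show ?thesis
        using norm_le_l1[of "x - y"] by (simp add: dist_norm \<epsilon>_def)
    qed
    have "finite G" by (simp add: G_def finite_PiE)
    have "covers \<delta> E \<U>"
      unfolding covers_def
    proof (intro conjI ballI)
      show "finite \<U>" using \<open>finite G\<close> by (simp add: \<U>_def)
      show "E \<subseteq> \<Union>\<U>" using inG by (auto simp: \<U>_def)
      fix U assume "U \<in> \<U>"
      then show "bounded U" using assms(1) bounded_subset by (auto simp: \<U>_def)
      show "diameter U \<le> \<delta>" using \<open>U \<in> \<U>\<close> near \<delta>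
        by (intro diameter_le) (auto simp: \<U>_def dist_norm)
    qed
    then have "covering_number \<delta> E \<le> card \<U>" by (rule covering_number_le_card)
    also have "\<dots> \<le> card G" using \<open>finite G\<close> by (simp add: \<U>_def card_image_le)
    also have "card G = nat (2 * K + 1) ^ DIM('a)"
      by (simp add: G_def card_PiE)
    finally have "real (covering_number \<delta> E) \<le> real (nat (2 * K + 1)) ^ DIM('a)"
      by (metis of_nat_le_iff of_nat_power)
    also have "\<dots> \<le> ((2 * R * ?d + 5) / \<delta>) ^ DIM('a)"
    proof (rule power_mono)
      have "0 \<le> R / \<epsilon>" using R \<epsilon> by simp
      then have "K \<ge> 0" unfolding K_def by linarith
      then have "real (nat (2 * K + 1)) = 2 * real_of_int K + 1" by simp
      also have "\<dots> \<le> 2 * (R / \<epsilon>) + 3"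
      proof -
        have "real_of_int K \<le> R / \<epsilon> + 1" by (simp add: K_def)
        then show ?thesis by linarith
      qed
      also have "\<dots> \<le> (2 * R * ?d + 5) / \<delta>" 
      proof -
        have "5 \<le> 5 / \<delta>" using \<delta> by (simp add: pos_le_divide_eq)
        moreover have "2 * (R / \<epsilon>) = 2 * R * ?d / \<delta>" by (simp add: \<epsilon>_def)
        ultimately show ?thesis by (simp add: add_divide_distrib)
      qed
      finally show "real (nat (2 * K + 1)) \<le> (2 * R * ?d + 5) / \<delta>" .
    qed simp
    also have "\<dots> = (2 * R * ?d + 5) ^ DIM('a) * \<delta> powr (- ?d)"
      using \<delta> by (simp add: power_divide powr_minus powr_realpow divide_inverse[symmetric])
    finally show ?thesis .
  qed
  show ?thesis
  proof (rule upper_box_dim_leI[OF assms])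
    show "0 < (2 * R * ?d + 5) ^ DIM('a)" using R by (simp add: add_nonneg_pos)
    show "\<forall>\<^sub>F \<delta> in at_right 0. real (covering_number \<delta> E) \<le> (2 * R * ?d + 5) ^ DIM('a) * \<delta> powr (- ?d)"
      using eventually_at_right_0_less[of 1, OF zero_less_one] by eventually_elim (use bound in auto)
  qed
qed

section \<open>Attractors of iterated function systems\<close>

lemma infdist_similarity_image_le:
  fixes f :: "'a::euclidean_space \<Rightarrow> 'a"
  assumes f: "\<And>x y. dist (f x) (f y) = r * dist x y" and "r \<ge> 0" "closed G" "G \<noteq> {}" "f ` G \<subseteq> G"
  shows "infdist (f y) G \<le> r * infdist y G"
proof -
  obtain z where "z \<in> G" "infdist y G = dist y z"
    using infdist_attains_inf assms by metis
  then show ?thesis using infdist_le[of "f z" G "f y"] f[of y z] assms by auto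
qed

locale similarity_ifs =
  fixes T :: "nat \<Rightarrow> 'a::euclidean_space \<Rightarrow> 'a" and Lip :: "nat \<Rightarrow> real" and N :: nat
  assumes N: "N \<ge> 1"
    and sim: "i \<in> {1..N} \<Longrightarrow> linear_contracting_similarity (T i) (Lip i)"
begin

lemma linear_T: "i \<in> {1..N} \<Longrightarrow> linear (T i)"
  and Lip_pos: "i \<in> {1..N} \<Longrightarrow> 0 < Lip i"
  and Lip_less_1: "i \<in> {1..N} \<Longrightarrow> Lip i < 1"
  and dist_T: "i \<in> {1..N} \<Longrightarrow> dist (T i x) (T i y) = Lip i * dist x y"
  using sim unfolding linear_contracting_similarity_def by blast+

lemma norm_T: "i \<in> {1..N} \<Longrightarrow> norm (T i x) = Lip i * norm x"
  using dist_T[of i x 0] linear_0[OF linear_T] by simp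

definition rmax :: real where "rmax = Max (Lip ` {1..N})"

lemma Lip_le_rmax: "i \<in> {1..N} \<Longrightarrow> Lip i \<le> rmax"
  by (simp add: rmax_def)

lemma rmax_attained: obtains i where "i \<in> {1..N}" "rmax = Lip i"
proof -
  have "rmax \<in> Lip ` {1..N}" unfolding rmax_def using N by (intro Max_in) auto
  then show ?thesis using that by auto
qed

lemma rmax_pos: "0 < rmax" and rmax_less_1: "rmax < 1"
  using rmax_attained Lip_pos Lip_less_1 by metis+

abbreviation hutchinson :: "(nat \<Rightarrow> 'a) \<Rightarrow> 'a set \<Rightarrow> 'a set \<Rightarrow> 'a set"
  where "hutchinson t C F \<equiv> (\<Union>i\<in>{1..N}. (\<lambda>x. T i x + t i) ` F) \<union> C"

text \<open>The point of \<open>F\<close> farthest from \<open>G\<close> lies in \<open>C \<subseteq> G\<close> or is an image of a point of \<open>F\<close>, so its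
  distance to \<open>G\<close> is at most \<open>rmax\<close> times the maximal distance, which must therefore vanish.\<close>

lemma sub_invariant_subset_super_invariant:
  assumes "compact F" "F \<subseteq> hutchinson t C F"
    and "closed G" "G \<noteq> {}" "hutchinson t C G \<subseteq> G"
  shows "F \<subseteq> G"
proof (cases "F = {}")
  case False
  have "continuous_on F (\<lambda>x. infdist x G)" by (intro continuous_intros)
  from continuous_attains_sup[OF \<open>compact F\<close> False this]
  obtain x where x: "x \<in> F" "\<And>y. y \<in> F \<Longrightarrow> infdist y G \<le> infdist x G" by blast
  have "infdist x G \<le> rmax * infdist x G"
  proof -
    consider "x \<in> C" | i y where "i \<in> {1..N}" "y \<in> F" "x = T i y + t i"
      using x(1) assms(2) by blast
    then show ?thesis
    proof cases
      case 1
      then have "x \<in> G" using assms(5) by auto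
      then show ?thesis by simp
    next
      case 2
      have "infdist x G \<le> Lip i * infdist y G"
        unfolding 2(3)
      proof (rule infdist_similarity_image_le[OF _ _ assms(3,4)])
        show "(\<lambda>x. T i x + t i) ` G \<subseteq> G" using assms(5) 2(1) by blast
      qed (use dist_T[OF 2(1)] Lip_pos[OF 2(1)] in auto)
      also have "\<dots> \<le> rmax * infdist x G"
        using x(2)[OF 2(2)] Lip_le_rmax[OF 2(1)] rmax_pos
        by (intro mult_mono) (auto simp: infdist_nonneg)
      finally show ?thesis .
    qed
  qed
  then have "(1 - rmax) * infdist x G \<le> 0" by (simp add: algebra_simps)
  then have "infdist x G \<le> 0" using rmax_less_1 by (simp add: mult_le_0_iff)
  show ?thesis
  proof
    fix y assume "y \<in> F"
    then have "infdist y G = 0"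
      using x(2)[of y] \<open>infdist x G \<le> 0\<close> infdist_nonneg[of y G] by linarith
    then show "y \<in> G" using in_closed_iff_infdist_zero[OF assms(3,4)] by simp
  qed
qed simp

lemma absorbing_ball:
  assumes "bounded C"
  obtains R where "R > 0" "hutchinson t C (cball 0 R) \<subseteq> cball 0 R"
proof -
  obtain B where B: "B > 0" "\<And>x. x \<in> C \<Longrightarrow> norm x \<le> B"
    using assms bounded_pos by metis
  define A where "A = (\<Sum>i\<in>{1..N}. norm (t i))"
  have A: "norm (t i) \<le> A" if "i \<in> {1..N}" for i
    unfolding A_def using that by (intro member_le_sum) auto
  have "A \<ge> 0" by (simp add: A_def sum_nonneg)
  define R where "R = B + A / (1 - rmax)"
  have "A / (1 - rmax) \<ge> 0" using \<open>A \<ge> 0\<close> rmax_less_1 by simp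
  have "R > 0" "B \<le> R" using B(1) \<open>A / (1 - rmax) \<ge> 0\<close> by (auto simp: R_def)
  have "rmax * R + A \<le> R"
  proof -
    have "(1 - rmax) * R = (1 - rmax) * B + A" using rmax_less_1 by (simp add: R_def distrib_left)
    moreover have "(1 - rmax) * B \<ge> 0" using B(1) rmax_less_1 by simp
    ultimately show ?thesis by (simp add: algebra_simps)
  qed
  have "norm (T i x + t i) \<le> R" if "i \<in> {1..N}" "norm x \<le> R" for i x
  proof -
    have "norm (T i x + t i) \<le> Lip i * norm x + norm (t i)"
      using norm_triangle_ineq[of "T i x" "t i"] norm_T[OF that(1)] by simp
    also have "\<dots> \<le> rmax * R + A"
      using that A Lip_le_rmax rmax_pos by (intro add_mono mult_mono) auto
    finally show ?thesis using \<open>rmax * R + A \<le> R\<close> by simp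
  qed
  then have "hutchinson t C (cball 0 R) \<subseteq> cball 0 R"
    using B(2) \<open>B \<le> R\<close> by (force simp: dist_norm)
  then show ?thesis using that \<open>R > 0\<close> by blast
qed

lemma compact_hutchinson:
  assumes "compact C" "compact F"
  shows "compact (hutchinson t C F)"
  using assms linear_T
  by (intro compact_Un compact_UN compact_continuous_image continuous_on_add
      continuous_on_const linear_continuous_on)
     (auto simp: linear_conv_bounded_linear)

text \<open>The iterates of an absorbing ball decrease to the attractor. For the inclusion of the
  intersection in its image, a point that lies in infinitely many of the sets
  \<open>T i (K n) + t i\<close> for one \<open>i\<close> has the same preimage in all of them, by injectivity.\<close>

lemma invariant_compact_exists:
  assumes "compact C"
  shows "\<exists>F. F \<noteq> {} \<and> compact F \<and> F = hutchinson t C F"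
proof -
  obtain R where R: "R > 0" "hutchinson t C (cball 0 R) \<subseteq> cball 0 R"
    using absorbing_ball[OF compact_imp_bounded[OF assms]] by blast
  define K where "K n = (hutchinson t C ^^ n) (cball 0 R)" for n
  have K_Suc: "K (Suc n) = hutchinson t C (K n)" for n by (simp add: K_def)
  have dec: "K (Suc n) \<subseteq> K n" for n
  proof (induction n)
    case 0 then show ?case using R(2) by (simp add: K_def)
  next
    case (Suc n)
    then have "hutchinson t C (K (Suc n)) \<subseteq> hutchinson t C (K n)" by blast
    then show ?case by (simp only: K_Suc)
  qed
  have cpt: "compact (K n)" for n
  proof (induction n)
    case (Suc n)
    then show ?case unfolding K_Suc by (intro compact_hutchinson assms)
  qed (simp add: K_def)
  have ne: "K n \<noteq> {}" for n
  proof (induction n)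
    case (Suc n)
    then show ?case unfolding K_Suc using N by auto
  qed (use R in \<open>simp add: K_def\<close>)
  have mono: "K n \<subseteq> K m" if "m \<le> n" for m n
    using that dec by (rule lift_Suc_antimono_le[of K, rotated]) 
  define F where "F = (\<Inter>n. K n)"
  have "F \<noteq> {}"
    unfolding F_def using compact_nest[of K] cpt ne mono by blast
  moreover have "compact F"
    unfolding F_def using cpt by (intro compact_Inter) auto
  moreover have "hutchinson t C F \<subseteq> F"
  proof -
    have "hutchinson t C F \<subseteq> K (Suc n)" for n unfolding K_Suc F_def by blast
    then have "hutchinson t C F \<subseteq> K n" for n using dec by blast
    then show ?thesis unfolding F_def by blast
  qed
  moreover have "F \<subseteq> hutchinson t C F"
  proof
    fix x assume "x \<in> F"
    show "x \<in> hutchinson t C F"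
    proof (cases "x \<in> C")
      case False
      have "\<forall>n. \<exists>i\<in>{1..N}. x \<in> (\<lambda>x. T i x + t i) ` K n"
        using \<open>x \<in> F\<close> False K_Suc unfolding F_def by blast
      then obtain i where i: "\<And>n. i n \<in> {1..N}" "\<And>n. x \<in> (\<lambda>x. T (i n) x + t (i n)) ` K n"
        by metis
      have "finite (range i)" using i(1) by (meson finite_atLeastAtMost finite_subset image_subsetI)
      then obtain k where k: "k \<in> range i" "infinite {n. i n = k}"
        using pigeonhole_infinite[of UNIV i] by auto
      have k_in: "k \<in> {1..N}" using k(1) i(1) by auto
      obtain n0 where "i n0 = k" using k(1) by auto
      then have "x \<in> (\<lambda>x. T k x + t k) ` K n0" using i(2)[of n0] by simp
      then obtain y where y: "x = T k y + t k" by blast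
      have "y \<in> K m" for m
      proof -
        obtain n where n: "n \<ge> m" "i n = k"
          using k(2) unfolding infinite_nat_iff_unbounded_le by auto
        then have "x \<in> (\<lambda>x. T k x + t k) ` K n" using i(2)[of n] by simp
        then obtain z where z: "z \<in> K n" "x = T k z + t k" by blast
        have "T k y = T k z" using y z(2) by (metis add_right_cancel)
        then have "Lip k * dist y z = 0" using dist_T[OF k_in, of y z] by simp
        then have "y = z" using Lip_pos[OF k_in] by simp
        then show ?thesis using z(1) mono[OF n(1)] by blast
      qed
      then show ?thesis using y k_in unfolding F_def by blast
    qed simp
  qed
  ultimately show ?thesis by blast
qed

lemma attractor_properties:
  assumes "compact C"
  shows "attractor N T t C \<noteq> {}" "compact (attractor N T t C)"
    "attractor N T t C = hutchinson t C (attractor N T t C)"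
proof -
  have "\<exists>!F. F \<noteq> {} \<and> compact F \<and> F = hutchinson t C F"
  proof (rule ex_ex1I[OF invariant_compact_exists[OF assms]])
    have "F \<subseteq> G" if "compact F" "F = hutchinson t C F" "G \<noteq> {}" "compact G" "G = hutchinson t C G" for F G
      by (rule sub_invariant_subset_super_invariant[OF that(1) equalityD1[OF that(2)]
            compact_imp_closed[OF that(4)] that(3) equalityD2[OF that(5)]])
    then show "F = G" if "F \<noteq> {} \<and> compact F \<and> F = hutchinson t C F"
      "G \<noteq> {} \<and> compact G \<and> G = hutchinson t C G" for F G
      using that by (meson subset_antisym)
  qed
  from theI'[OF this] show "attractor N T t C \<noteq> {}" "compact (attractor N T t C)"
    "attractor N T t C = hutchinson t C (attractor N T t C)"
    unfolding attractor_def by blast+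
qed

lemma attractor_empty_subset:
  assumes "compact C"
  shows "attractor N T t {} \<subseteq> attractor N T t C"
proof (rule sub_invariant_subset_super_invariant)
  show "hutchinson t {} (attractor N T t C) \<subseteq> attractor N T t C"
    using attractor_properties(3)[OF assms, of t] by blast
  show "attractor N T t {} \<subseteq> hutchinson t {} (attractor N T t {})"
    using attractor_properties(3)[OF compact_empty, of t] by blast
qed (simp_all add: attractor_properties(1,2) assms compact_imp_closed)

lemma condensation_subset_attractor: "compact C \<Longrightarrow> C \<subseteq> attractor N T t C"
  using attractor_properties(3) by blast

end

section \<open>The similarity dimension bounds the upper box dimension\<close>

context similarity_ifs
begin

lemma similarity_dimension_exists:
  obtains s where "0 \<le> s" "(\<Sum>i\<in>{1..N}. Lip i powr s) = 1"
proof -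
  let ?g = "\<lambda>s. \<Sum>i\<in>{1..N}. Lip i powr s"
  obtain n where n: "rmax ^ n < 1 / real N"
    using real_arch_pow_inv[of "1 / real N" rmax] N rmax_less_1 by auto
  have "?g (real n) \<le> (\<Sum>i\<in>{1..N}. rmax ^ n)"
  proof (rule sum_mono)
    fix i assume i: "i \<in> {1..N}"
    show "Lip i powr real n \<le> rmax ^ n"
      using power_mono[of "Lip i" rmax n] Lip_pos[OF i] Lip_le_rmax[OF i] by (simp add: powr_realpow)
  qed
  also have "\<dots> \<le> 1" using n N by (simp add: field_simps)
  finally have "?g (real n) \<le> 1" .
  moreover have "1 \<le> ?g 0"
  proof -
    have "?g 0 = (\<Sum>i\<in>{1..N}. 1)" using Lip_pos by (intro sum.cong) (auto simp: less_imp_neq[symmetric])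
    then show ?thesis using N by simp
  qed
  moreover have "continuous_on {0..real n} ?g"
    using Lip_pos by (intro continuous_intros) (auto simp: less_imp_neq[symmetric])
  ultimately show ?thesis
    using IVT2'[of ?g "real n" 1 0] that by auto
qed

lemma covering_number_attractor_le:
  fixes t :: "nat \<Rightarrow> 'a"
  assumes "compact C" "\<delta> > 0"
  defines "F \<equiv> attractor N T t C"
  shows "covering_number \<delta> F \<le> (\<Sum>i\<in>{1..N}. covering_number (\<delta> / Lip i) F) + covering_number \<delta> C"
proof -
  have bF: "bounded F" unfolding F_def by (intro compact_imp_bounded attractor_properties assms)
  have b: "bounded ((\<lambda>x. T i x + t i) ` F)" if "i \<in> {1..N}" for i
    using bounded_linear_image[OF bF, of "T i"] linear_T[OF that]
      bounded_translation[of "T i ` F" "t i"]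
    by (simp add: image_image linear_conv_bounded_linear add.commute)
  have "covering_number \<delta> F = covering_number \<delta> (hutchinson t C F)"
    unfolding F_def using attractor_properties(3)[OF assms(1), of t] by (rule arg_cong)
  also have "\<dots> \<le> covering_number \<delta> (\<Union>i\<in>{1..N}. (\<lambda>x. T i x + t i) ` F) + covering_number \<delta> C"
    using b assms compact_imp_bounded by (intro covering_number_Un bounded_UN) auto
  also have "covering_number \<delta> (\<Union>i\<in>{1..N}. (\<lambda>x. T i x + t i) ` F)
      \<le> (\<Sum>i\<in>{1..N}. covering_number \<delta> ((\<lambda>x. T i x + t i) ` F))"
    using b assms by (intro covering_number_UN) auto
  also have "\<dots> \<le> (\<Sum>i\<in>{1..N}. covering_number (\<delta> / Lip i) F)"
    using dist_T Lip_pos bF assms by (intro sum_mono covering_number_similarity_image) auto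
  finally show ?thesis by simp
qed

text \<open>Let \<open>u\<close> exceed both the similarity dimension and the dimension of \<open>C\<close>. The recursion
  \<open>N\<^sub>\<delta> F \<le> (\<Sum>i. N\<^bsub>\<delta>/Lip i\<^esub> F) + N\<^sub>\<delta> C\<close> preserves a bound
  \<open>N\<^sub>\<delta> F \<le> M \<delta>\<^bsup>-u\<^esup>\<close>, because \<open>\<Sum>i. (Lip i)\<^bsup>u\<^esup> < 1\<close> leaves room for the
  contribution of \<open>C\<close>; starting from a fixed scale it reaches all smaller ones.\<close>

lemma upper_box_dim_attractor_le:
  assumes C: "compact C" "C \<noteq> {}" and s: "(\<Sum>i\<in>{1..N}. Lip i powr s) = 1"
  shows "upper_box_dim (attractor N T t C) \<le> max (ereal s) (upper_box_dim C)"
proof (rule dense_ge)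
  fix z assume z: "max (ereal s) (upper_box_dim C) < z"
  define F where "F = attractor N T t C"
  have F: "F \<noteq> {}" "bounded F"
    unfolding F_def using attractor_properties(1,2)[OF C(1)] compact_imp_bounded by auto
  show "upper_box_dim (attractor N T t C) \<le> z"
  proof (cases z)
    case (real u)
    then have u: "s < u" "upper_box_dim C < ereal u" using z by auto
    define q where "q = (\<Sum>i\<in>{1..N}. Lip i powr u)"
    have "q < (\<Sum>i\<in>{1..N}. Lip i powr s)"
      unfolding q_def using N u(1) Lip_pos Lip_less_1
      by (intro sum_strict_mono powr_less_mono') auto
    then have "q < 1" using s by simp
    obtain b where b: "b > 0" "\<And>\<delta>. 0 < \<delta> \<Longrightarrow> \<delta> < b \<Longrightarrow> real (covering_number \<delta> C) \<le> \<delta> powr (- u)"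
      using covering_number_le_of_upper_box_dim_less[OF compact_imp_bounded[OF C(1)] C(2) u(2)]
      unfolding eventually_at_right_field by auto
    define rmin where "rmin = Min (Lip ` {1..N})"
    have rmin: "rmin > 0" "\<And>i. i \<in> {1..N} \<Longrightarrow> rmin \<le> Lip i"
      using N Lip_pos by (auto simp: rmin_def)
    define D where "D = b / rmin"
    define M where "M = max (1 / (1 - q)) (real (covering_number b F) * max (b powr u) (D powr u))"
    have "M \<ge> 0" unfolding M_def using \<open>q < 1\<close> by (simp add: le_max_iff_disj)
    have step: "real (covering_number \<delta> F) \<le> M * \<delta> powr (- u)"
      if "b * rmax ^ k \<le> \<delta>" "\<delta> \<le> D" for k \<delta>
      using that
    proof (induction k arbitrary: \<delta>)
      case 0
      have "\<delta> > 0" using 0 b by auto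
      have "\<delta> powr u \<le> max (b powr u) (D powr u)"
      proof (cases "u \<ge> 0")
        case True
        then have "\<delta> powr u \<le> D powr u" using 0 \<open>\<delta> > 0\<close> by (intro powr_mono2) auto
        then show ?thesis by simp
      next
        case False
        then have "\<delta> powr u \<le> b powr u" using 0 b by (intro powr_mono2') auto
        then show ?thesis by simp
      qed
      then have "real (covering_number b F) * \<delta> powr u \<le> M"
        unfolding M_def by (rule max.coboundedI2[OF mult_left_mono]) simp
      then have "real (covering_number b F) \<le> M * \<delta> powr (- u)"
        using \<open>\<delta> > 0\<close> by (simp add: powr_minus field_simps)
      moreover have "covering_number \<delta> F \<le> covering_number b F"
        using 0 b F by (intro covering_number_mono) auto
      ultimately show ?case by linarith
    next
      case (Suc k)
      show ?case
      proof (cases "\<delta> < b")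
        case False
        have "rmax ^ k \<le> 1" using rmax_pos rmax_less_1 by (intro power_le_one) auto
        then have "b * rmax ^ k \<le> b * 1" using b(1) by (intro mult_left_mono) auto
        then have "b * rmax ^ k \<le> \<delta>" using False by linarith
        then show ?thesis using Suc by blast
      next
        case True
        have "\<delta> > 0" using Suc.prems b rmax_pos by (meson less_le_trans mult_pos_pos zero_less_power)
        have IH: "real (covering_number (\<delta> / Lip i) F) \<le> M * (\<delta> powr (- u) * Lip i powr u)"
          if i: "i \<in> {1..N}" for i
        proof -
          have "b * rmax ^ k * Lip i \<le> b * rmax ^ Suc k"
            using Lip_le_rmax[OF i] b rmax_pos by simp
          then have "b * rmax ^ k \<le> \<delta> / Lip i"
            using Suc.prems Lip_pos[OF i] by (simp add: pos_le_divide_eq)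
          moreover have "\<delta> / Lip i \<le> D"
            unfolding D_def using True \<open>\<delta> > 0\<close> rmin(1) rmin(2)[OF i] by (intro frac_le) auto
          ultimately have "real (covering_number (\<delta> / Lip i) F) \<le> M * (\<delta> / Lip i) powr (- u)"
            by (rule Suc.IH)
          also have "(\<delta> / Lip i) powr (- u) = \<delta> powr (- u) * Lip i powr u"
            using \<open>\<delta> > 0\<close> Lip_pos[OF i] by (simp add: powr_divide powr_minus divide_simps)
          finally show ?thesis .
        qed
        have "1 + q * M \<le> M"
        proof -
          have "1 / (1 - q) \<le> M" by (simp add: M_def)
          then have "1 \<le> M * (1 - q)" using \<open>q < 1\<close> by (simp add: divide_le_eq)
          then show ?thesis by (simp add: algebra_simps)
        qed
        have "real (covering_number \<delta> F) \<le> (\<Sum>i\<in>{1..N}. real (covering_number (\<delta> / Lip i) F))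
            + real (covering_number \<delta> C)"
          using covering_number_attractor_le[OF C(1) \<open>\<delta> > 0\<close>, of t] unfolding F_def
          by (metis of_nat_add of_nat_le_iff of_nat_sum)
        also have "\<dots> \<le> (\<Sum>i\<in>{1..N}. M * (\<delta> powr (- u) * Lip i powr u)) + \<delta> powr (- u)"
          using IH b True \<open>\<delta> > 0\<close> by (intro add_mono sum_mono) auto
        also have "\<dots> = (1 + q * M) * \<delta> powr (- u)"
          by (simp add: q_def sum_distrib_left sum_distrib_right algebra_simps)
        also have "\<dots> \<le> M * \<delta> powr (- u)"
          using \<open>1 + q * M \<le> M\<close> by (intro mult_right_mono) auto
        finally show ?thesis .
      qed
    qed
    have bound: "real (covering_number \<delta> F) \<le> M * \<delta> powr (- u)" if \<delta>: "0 < \<delta>" "\<delta> < D" for \<delta>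
    proof -
      obtain k where "rmax ^ k < \<delta> / b"
        using real_arch_pow_inv[of "\<delta> / b" rmax] \<delta> b rmax_less_1 by auto
      then have "b * rmax ^ k \<le> \<delta>" using b by (simp add: field_simps)
      then show ?thesis using step \<delta> by auto
    qed
    have "D > 0" using b rmin by (simp add: D_def)
    have "upper_box_dim F \<le> ereal u"
    proof (rule upper_box_dim_leI[OF F(2,1)])
      show "0 < max 1 M" by simp
      show "\<forall>\<^sub>F \<delta> in at_right 0. real (covering_number \<delta> F) \<le> max 1 M * \<delta> powr (- u)"
        using eventually_at_right_0_less[OF \<open>D > 0\<close>]
      proof eventually_elim
        case (elim \<delta>)
        have "real (covering_number \<delta> F) \<le> M * \<delta> powr (- u)" using bound elim by simp
        also have "\<dots> \<le> max 1 M * \<delta> powr (- u)" by (intro mult_right_mono) auto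
        finally show ?case .
      qed
    qed
    then show ?thesis using real by (simp add: F_def)
  qed (use z in auto)
qed

end

section \<open>Transversality\<close>

context similarity_ifs
begin

primrec words :: "nat \<Rightarrow> nat list set"
  where "words 0 = {[]}"
  | "words (Suc n) = (\<lambda>(i, I). i # I) ` ({1..N} \<times> words n)"

primrec word_map :: "(nat \<Rightarrow> 'a) \<Rightarrow> nat list \<Rightarrow> 'a \<Rightarrow> 'a"
  where "word_map t [] x = x"
  | "word_map t (i # I) x = T i (word_map t I x) + t i"

text \<open>A Lipschitz constant for \<open>word_map t I x\<close> as a function of the \<open>k\<close>-th translation
  \<open>t k\<close>: each occurrence of \<open>k\<close> in \<open>I\<close> contributes the ratio of the prefix before it.\<close>

primrec translation_lip :: "nat \<Rightarrow> nat list \<Rightarrow> real"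
  where "translation_lip k [] = 0"
  | "translation_lip k (i # I) = (if i = k then 1 else 0) + Lip i * translation_lip k I"

lemma words_Suc_cases:
  assumes "I \<in> words (Suc n)"
  obtains i J where "i \<in> {1..N}" "J \<in> words n" "I = i # J"
  using assms by auto

lemma finite_words: "finite (words n)"
  by (induction n) auto

lemma sum_words_Suc: "(\<Sum>I\<in>words (Suc n). f I) = (\<Sum>i\<in>{1..N}. \<Sum>I\<in>words n. f (i # I))"
proof -
  have "inj_on (\<lambda>(i, I). i # I) ({1..N} \<times> words n)" by (auto simp: inj_on_def)
  then show ?thesis
    by (simp add: sum.reindex sum.cartesian_product case_prod_unfold comp_def)
qed

lemma translation_lip_nonneg: "I \<in> words n \<Longrightarrow> 0 \<le> translation_lip k I"
proof (induction n arbitrary: I)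
  case (Suc n)
  obtain i J where "i \<in> {1..N}" "J \<in> words n" "I = i # J"
    using Suc.prems by (rule words_Suc_cases)
  then show ?case using Suc.IH[of J] Lip_pos[of i] by simp
qed simp

lemma word_map_translation_lip:
  "I \<in> words n \<Longrightarrow>
    norm (word_map (t(k := u)) I x - word_map (t(k := v)) I x) \<le> translation_lip k I * norm (u - v)"
proof (induction n arbitrary: I)
  case (Suc n)
  obtain i J where I: "i \<in> {1..N}" "J \<in> words n" "I = i # J"
    using Suc.prems by (rule words_Suc_cases)
  let ?d = "word_map (t(k := u)) J x - word_map (t(k := v)) J x"
  have "word_map (t(k := u)) I x - word_map (t(k := v)) I x
      = T i ?d + (if i = k then u - v else 0)"
    using I linear_diff[OF linear_T[OF I(1)]] by simp
  also have "norm \<dots> \<le> Lip i * norm ?d + (if i = k then 1 else 0) * norm (u - v)"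
    using norm_triangle_ineq[of "T i ?d" "if i = k then u - v else 0"] norm_T[OF I(1), of ?d] by auto
  also have "\<dots> \<le> Lip i * (translation_lip k J * norm (u - v)) + (if i = k then 1 else 0) * norm (u - v)"
    by (intro add_right_mono mult_left_mono Suc.IH[OF I(2)] less_imp_le[OF Lip_pos[OF I(1)]])
  also have "\<dots> = translation_lip k I * norm (u - v)"
    using I by (simp add: algebra_simps)
  finally show ?case .
qed simp

text \<open>At each depth at most one of the two letters occurs, so the two constants together are
  bounded by a single geometric series.\<close>

lemma translation_lip_add_le:
  assumes "k \<noteq> l"
  shows "I \<in> words n \<Longrightarrow> translation_lip k I + translation_lip l I \<le> 1 / (1 - rmax)"
proof (induction n arbitrary: I)
  case 0
  then show ?case using rmax_less_1 by simp
next
  case (Suc n)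
  obtain i J where I: "i \<in> {1..N}" "J \<in> words n" "I = i # J"
    using Suc.prems by (rule words_Suc_cases)
  have "translation_lip k I + translation_lip l I
      \<le> 1 + Lip i * (translation_lip k J + translation_lip l J)"
    using \<open>k \<noteq> l\<close> I by (auto simp: algebra_simps)
  also have "\<dots> \<le> 1 + rmax * (1 / (1 - rmax))"
    using Suc.IH[OF I(2)] Lip_le_rmax[OF I(1)] Lip_pos[OF I(1)] rmax_pos
      translation_lip_nonneg[OF I(2)] by (intro add_left_mono mult_mono) auto
  also have "\<dots> = 1 / (1 - rmax)"
    using rmax_less_1 by (simp add: field_simps)
  finally show ?case .
qed

text \<open>Changing \<open>t i\<close> (or \<open>t j\<close>) moves the difference below by the same amount, up to a perturbation
  inherited from the tails \<open>I\<close> and \<open>J\<close>. The Lipschitz constants of the perturbations in \<open>t i\<close> and in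
  \<open>t j\<close> add up to at most \<open>2 * rmax / (1 - rmax)\<close>, so that one of them is at most
  \<open>rmax / (1 - rmax)\<close>, which is less than \<open>1\<close> precisely when \<open>rmax < 1 / 2\<close>.\<close>

lemma word_map_difference_expanding:
  fixes x :: 'a
  assumes ij: "i \<in> {1..N}" "j \<in> {1..N}" "i \<noteq> j" and I: "I \<in> words n" and J: "J \<in> words n"
  defines "g \<equiv> \<lambda>t. word_map t (i # I) x - word_map t (j # J) x"
  shows "\<exists>k\<in>{i, j}. \<forall>t u v. (1 - rmax / (1 - rmax)) * norm (u - v) \<le> norm (g (t(k := u)) - g (t(k := v)))"
proof -
  define e where "e k = Lip i * translation_lip k I + Lip j * translation_lip k J" for k
  have "e i + e j = Lip i * (translation_lip i I + translation_lip j I)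
      + Lip j * (translation_lip i J + translation_lip j J)"
    by (simp add: e_def algebra_simps)
  also have "\<dots> \<le> rmax * (1 / (1 - rmax)) + rmax * (1 / (1 - rmax))"
    using translation_lip_add_le[OF ij(3)] translation_lip_nonneg Lip_le_rmax Lip_pos rmax_pos ij I J
    by (intro add_mono mult_mono add_nonneg_nonneg) (auto intro: less_imp_le)
  finally have "e i \<le> rmax / (1 - rmax) \<or> e j \<le> rmax / (1 - rmax)"
    by (simp only: times_divide_eq_right mult_1_right) linarith
  then obtain k where k: "k \<in> {i, j}" "e k \<le> rmax / (1 - rmax)" by blast
  have "(1 - rmax / (1 - rmax)) * norm (u - v) \<le> norm (g (t(k := u)) - g (t(k := v)))" for t u v
  proof -
    let ?I = "word_map (t(k := u)) I x - word_map (t(k := v)) I x"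
    let ?J = "word_map (t(k := u)) J x - word_map (t(k := v)) J x"
    define w where "w = (if k = i then u - v else v - u)"
    have g: "g (t(k := u)) - g (t(k := v)) = w + (T i ?I - T j ?J)"
      using k(1) ij linear_diff[OF linear_T] by (auto simp: g_def w_def)
    have "norm (T i ?I - T j ?J) \<le> norm (T i ?I) + norm (T j ?J)" by (rule norm_triangle_ineq4)
    also have "\<dots> = Lip i * norm ?I + Lip j * norm ?J" using norm_T ij by simp
    also have "\<dots> \<le> Lip i * (translation_lip k I * norm (u - v)) + Lip j * (translation_lip k J * norm (u - v))"
      using word_map_translation_lip[OF I] word_map_translation_lip[OF J] Lip_pos ij
      by (intro add_mono mult_left_mono) (auto intro: less_imp_le)
    also have "\<dots> = e k * norm (u - v)" by (simp add: e_def algebra_simps)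
    also have "\<dots> \<le> rmax / (1 - rmax) * norm (u - v)" using k by (intro mult_right_mono) auto
    finally have "norm (T i ?I - T j ?J) \<le> rmax / (1 - rmax) * norm (u - v)" .
    moreover have "norm w = norm (u - v)" by (simp add: w_def norm_minus_commute)
    ultimately show ?thesis
      unfolding g using norm_diff_ineq[of w "T i ?I - T j ?J"]
      by (simp only: left_diff_distrib mult_1_left)
  qed
  then show ?thesis using k(1) by blast
qed

section \<open>The measure of parameters with close pairs\<close>

abbreviation params :: "(nat \<Rightarrow> 'a) measure"
  where "params \<equiv> \<Pi>\<^sub>M i\<in>{1..N}. lborel"

definition box :: "real \<Rightarrow> (nat \<Rightarrow> 'a) set"
  where "box R = (\<Pi>\<^sub>E i\<in>{1..N}. cball 0 R)"

definition close_params :: "real \<Rightarrow> real \<Rightarrow> nat list \<Rightarrow> nat list \<Rightarrow> (nat \<Rightarrow> 'a) set"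
  where "close_params R \<rho> I J = {t \<in> box R. norm (word_map t I 0 - word_map t J 0) \<le> \<rho>}"

lemma box_in_sets [measurable]: "box R \<in> sets params"
  unfolding box_def by (intro sets_PiM_I_finite) auto

lemma emeasure_box: "emeasure params (box R) < \<infinity>"
proof -
  interpret product_sigma_finite "\<lambda>_::nat. lborel :: 'a measure" ..
  have "emeasure params (box R) = (\<Prod>i\<in>{1..N}. emeasure lborel (cball 0 R :: 'a set))"
    unfolding box_def by (intro emeasure_PiM) auto
  also have "emeasure lborel (cball 0 R :: 'a set) = ennreal (measure lborel (cball 0 R :: 'a set))"
    by (intro emeasure_eq_ennreal_measure less_imp_neq)
      (use emeasure_lborel_cball_finite[of "0::'a" R] in \<open>simp add: top.not_eq_extremum\<close>)
  also have "(\<Prod>i\<in>{1..N}. ennreal (measure lborel (cball 0 R :: 'a set))) < \<infinity>"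
    by (simp add: ennreal_power)
  finally show ?thesis .
qed

lemma measurable_word_map:
  "I \<in> words n \<Longrightarrow> (\<lambda>t. word_map t I x) \<in> borel_measurable params"
proof (induction n arbitrary: I)
  case (Suc n)
  obtain i J where I: "i \<in> {1..N}" "J \<in> words n" "I = i # J"
    using Suc.prems by (rule words_Suc_cases)
  have "T i \<in> borel_measurable borel"
    using linear_T[OF I(1)]
    by (intro borel_measurable_continuous_onI linear_continuous_on) (simp add: linear_conv_bounded_linear)
  then have "(\<lambda>t. T i (word_map t J x)) \<in> borel_measurable params"
    using Suc.IH[OF I(2)] by (rule measurable_compose_rev)
  moreover have "(\<lambda>t. t i) \<in> borel_measurable params"
    using measurable_component_singleton[OF I(1), of "\<lambda>_. lborel"] by simp
  ultimately show ?case using I by simp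
qed simp

lemma close_params_in_sets:
  assumes "I \<in> words n" "J \<in> words n"
  shows "close_params R \<rho> I J \<in> sets params"
proof -
  note [measurable] = measurable_word_map[OF assms(1)] measurable_word_map[OF assms(2)]
  have "close_params R \<rho> I J = box R \<inter> {t \<in> space params. norm (word_map t I 0 - word_map t J 0) \<le> \<rho>}"
    using sets.sets_into_space[OF box_in_sets, of R] unfolding close_params_def by blast
  also have "\<dots> \<in> sets params" by measurable
  finally show ?thesis .
qed

lemma emeasure_close_params:
  assumes "I \<in> words n" "J \<in> words n"
  shows "emeasure params (close_params R \<rho> I J) \<le> emeasure params (box R)"
    "emeasure params (close_params R \<rho> I J) < \<infinity>"
proof -
  show "emeasure params (close_params R \<rho> I J) \<le> emeasure params (box R)"
    by (rule emeasure_mono[OF _ box_in_sets]) (auto simp: close_params_def)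
  then show "emeasure params (close_params R \<rho> I J) < \<infinity>" using emeasure_box by (rule le_less_trans)
qed

definition transversality_const :: "real \<Rightarrow> real"
  where "transversality_const R = measure lborel (cball 0 R :: 'a set) ^ (N - 1) *
    (unit_ball_vol DIM('a) * (2 / (1 - rmax / (1 - rmax))) ^ DIM('a))"

text \<open>Integrate first over a coordinate on which the difference of the two points depends
  expandingly: once the other coordinates are fixed, the parameters in question lie in a ball of
  radius \<open>O(\<rho>)\<close>.\<close>

lemma measure_close_params_le:
  assumes half: "rmax < 1 / 2" and ij: "i \<in> {1..N}" "j \<in> {1..N}" "i \<noteq> j"
    and I: "I \<in> words n" and J: "J \<in> words n" and "R \<ge> 0" "\<rho> \<ge> 0"
  shows "measure params (close_params R \<rho> (i # I) (j # J)) \<le> transversality_const R * \<rho> ^ DIM('a)"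
proof -
  interpret product_sigma_finite "\<lambda>_::nat. lborel :: 'a measure" ..
  let ?S = "close_params R \<rho> (i # I) (j # J)"
  define \<gamma> where "\<gamma> = 1 - rmax / (1 - rmax)"
  define g where "g t = word_map t (i # I) 0 - word_map t (j # J) 0" for t
  have "\<gamma> > 0" using half by (simp add: \<gamma>_def)
  obtain k where k: "k \<in> {i, j}" "\<And>t u v. \<gamma> * norm (u - v) \<le> norm (g (t(k := u)) - g (t(k := v)))"
    using word_map_difference_expanding[OF ij I J, of 0] unfolding \<gamma>_def g_def by blast
  define A where "A = {1..N} - {k}"
  have kN: "k \<in> {1..N}" using k(1) ij by auto
  then have A: "{1..N} = insert k A" "finite A" "k \<notin> A" by (auto simp: A_def)
  have S: "?S \<in> sets params"
    using ij I J by (intro close_params_in_sets[where n = "Suc n"]) auto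
  define \<beta> where "\<beta> = unit_ball_vol DIM('a) * (2 * \<rho> / \<gamma>) ^ DIM('a)"
  have fibre: "(\<integral>\<^sup>+y. indicator ?S (x(k := y)) \<partial>lborel) \<le> ennreal \<beta> * indicator (\<Pi>\<^sub>E i\<in>A. cball (0::'a) R) x"
    if "x \<in> space (\<Pi>\<^sub>M i\<in>A. lborel)" for x
  proof (cases "\<exists>y0. x(k := y0) \<in> ?S")
    case True
    then obtain y0 where y0: "x(k := y0) \<in> ?S" ..
    have "x \<in> (\<Pi>\<^sub>E i\<in>A. cball (0::'a) R)"
    proof -
      have "x \<in> extensional A" using that by (simp add: space_PiM PiE_def)
      moreover have "x l \<in> cball 0 R" if "l \<in> A" for l
      proof -
        have "(x(k := y0)) l \<in> cball 0 R" using y0 that A unfolding close_params_def box_def by blast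
        moreover have "l \<noteq> k" using that A(3) by blast
        ultimately show ?thesis by simp
      qed
      ultimately show ?thesis by (auto simp: PiE_def)
    qed
    moreover have "indicator ?S (x(k := y)) \<le> (indicator (cball y0 (2 * \<rho> / \<gamma>)) y :: ennreal)" for y
    proof (cases "x(k := y) \<in> ?S")
      case True
      have "norm (g (x(k := y0))) \<le> \<rho>" "norm (g (x(k := y))) \<le> \<rho>"
        using True y0 by (auto simp: close_params_def g_def)
      then have "\<gamma> * norm (y0 - y) \<le> 2 * \<rho>"
        using k(2)[of y0 y x] norm_triangle_ineq4[of "g (x(k := y0))" "g (x(k := y))"] by linarith
      then have "y \<in> cball y0 (2 * \<rho> / \<gamma>)"
        using \<open>\<gamma> > 0\<close> by (simp add: dist_norm pos_le_divide_eq mult.commute)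
      then show ?thesis using True by simp
    qed simp
    then have "(\<integral>\<^sup>+y. indicator ?S (x(k := y)) \<partial>lborel) \<le> (\<integral>\<^sup>+y. indicator (cball y0 (2 * \<rho> / \<gamma>)) y \<partial>lborel)"
      by (rule nn_integral_mono)
    moreover have "\<dots> = ennreal \<beta>"
      using \<open>\<gamma> > 0\<close> \<open>\<rho> \<ge> 0\<close> by (simp add: emeasure_cball \<beta>_def)
    ultimately show ?thesis by simp
  qed simp
  have "emeasure params ?S = (\<integral>\<^sup>+t. indicator ?S t \<partial>(\<Pi>\<^sub>M i\<in>insert k A. lborel))"
    using S unfolding A(1) by simp
  also have "\<dots> = (\<integral>\<^sup>+x. (\<integral>\<^sup>+y. indicator ?S (x(k := y)) \<partial>lborel) \<partial>(\<Pi>\<^sub>M i\<in>A. lborel))"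
    using S A unfolding A(1) by (intro product_nn_integral_insert) auto
  also have "\<dots> \<le> (\<integral>\<^sup>+x. ennreal \<beta> * indicator (\<Pi>\<^sub>E i\<in>A. cball (0::'a) R) x \<partial>(\<Pi>\<^sub>M i\<in>A. lborel))"
    by (intro nn_integral_mono fibre)
  also have "\<dots> = ennreal \<beta> * emeasure (\<Pi>\<^sub>M i\<in>A. lborel) (\<Pi>\<^sub>E i\<in>A. cball (0::'a) R)"
    using A by (intro nn_integral_cmult_indicator sets_PiM_I_finite) auto
  also have "emeasure (\<Pi>\<^sub>M i\<in>A. lborel) (\<Pi>\<^sub>E i\<in>A. cball (0::'a) R) = (\<Prod>i\<in>A. emeasure lborel (cball 0 R :: 'a set))"
    using A by (intro emeasure_PiM) auto
  also have "\<dots> = emeasure lborel (cball 0 R :: 'a set) ^ (N - 1)"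
    using kN by (simp add: A_def)
  also have "emeasure lborel (cball 0 R :: 'a set) = ennreal (measure lborel (cball 0 R :: 'a set))"
    by (intro emeasure_eq_ennreal_measure less_imp_neq)
      (use emeasure_lborel_cball_finite[of "0::'a" R] in \<open>simp add: top.not_eq_extremum\<close>)
  finally have "emeasure params ?S \<le> ennreal (\<beta> * measure lborel (cball 0 R :: 'a set) ^ (N - 1))"
    using \<open>\<gamma> > 0\<close> \<open>\<rho> \<ge> 0\<close> by (simp add: ennreal_mult ennreal_power \<beta>_def)
  then have "measure params ?S \<le> \<beta> * measure lborel (cball 0 R :: 'a set) ^ (N - 1)"
    using \<open>\<gamma> > 0\<close> \<open>\<rho> \<ge> 0\<close> unfolding measure_def by (intro enn2real_leI) (auto simp: \<beta>_def)
  also have "\<dots> = transversality_const R * \<rho> ^ DIM('a)"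
    by (simp add: \<beta>_def transversality_const_def \<gamma>_def power_mult_distrib power_divide)
  finally show ?thesis .
qed

end

section \<open>Energy estimates\<close>

context similarity_ifs
begin

primrec weight :: "real \<Rightarrow> nat list \<Rightarrow> real"
  where "weight s [] = 1"
  | "weight s (i # I) = Lip i powr s * weight s I"

lemma weight_nonneg: "0 \<le> weight s I"
  by (induction I) auto

definition expected_energy :: "real \<Rightarrow> real \<Rightarrow> nat \<Rightarrow> real \<Rightarrow> real"
  where "expected_energy s R n \<rho> = (\<Sum>I\<in>words n. \<Sum>J\<in>words n.
    weight s I * weight s J * measure params (close_params R \<rho> I J))"

text \<open>The weight of the pairs of words of length \<open>n\<close> whose points are \<open>\<rho>\<close>-close, that is, the
  \<open>\<mu> \<times> \<mu>\<close>-measure of the \<open>\<rho>\<close>-neighbourhood of the diagonal for the discrete measure \<open>\<mu>\<close> that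
  puts mass \<open>weight s I\<close> on the point of \<open>I\<close>.\<close>

definition energy :: "real \<Rightarrow> nat \<Rightarrow> real \<Rightarrow> (nat \<Rightarrow> 'a) \<Rightarrow> real"
  where "energy s n \<rho> t = (\<Sum>I\<in>words n. \<Sum>J\<in>words n.
    weight s I * weight s J * of_bool (norm (word_map t I 0 - word_map t J 0) \<le> \<rho>))"

lemma close_params_Cons_same:
  assumes "i \<in> {1..N}"
  shows "close_params R \<rho> (i # I) (i # J) = close_params R (\<rho> / Lip i) I J"
proof -
  have "norm (word_map t (i # I) 0 - word_map t (i # J) 0)
      = Lip i * norm (word_map t I 0 - word_map t J 0)" for t
    using dist_T[OF assms] by (simp add: dist_norm)
  then show ?thesis
    using Lip_pos[OF assms] by (auto simp: close_params_def pos_le_divide_eq mult.commute)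
qed

end

text \<open>Here \<open>s\<close> is the similarity dimension, so that the weights of the words of a given length add
  up to \<open>1\<close>, and \<open>m\<close> is the exponent of the energy estimates; the lower bound for the dimension is
  obtained with \<open>m = min s DIM('a)\<close>.\<close>

locale similarity_ifs_dim = similarity_ifs T Lip N
  for T :: "nat \<Rightarrow> 'a::euclidean_space \<Rightarrow> 'a" and Lip N +
  fixes s m :: real
  assumes s: "(\<Sum>i\<in>{1..N}. Lip i powr s) = 1"
    and m: "0 \<le> m" "m \<le> s" "m \<le> DIM('a)"
    and half: "rmax < 1 / 2"
begin

lemma sum_weight: "(\<Sum>I\<in>words n. weight s I) = 1"
proof (induction n)
  case (Suc n)
  then show ?case
    unfolding sum_words_Suc using s by (simp add: sum_distrib_left[symmetric])
qed simp

lemma measure_close_params_le_powr: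
  assumes "i \<in> {1..N}" "j \<in> {1..N}" "i \<noteq> j" "I \<in> words n" "J \<in> words n" "R \<ge> 0" "\<rho> > 0"
  shows "measure params (close_params R \<rho> (i # I) (j # J))
    \<le> (transversality_const R + measure params (box R)) * \<rho> powr m"
proof (cases "\<rho> \<le> 1")
  case True
  have "transversality_const R \<ge> 0"
    using half by (simp add: transversality_const_def)
  have "\<rho> ^ DIM('a) \<le> \<rho> powr m"
    using True assms(7) m(3) powr_mono'[of m "DIM('a)" \<rho>] by (simp add: powr_realpow)
  have "measure params (close_params R \<rho> (i # I) (j # J)) \<le> transversality_const R * \<rho> ^ DIM('a)"
    using assms half by (intro measure_close_params_le) auto
  also have "\<dots> \<le> (transversality_const R + measure params (box R)) * \<rho> powr m"
    using \<open>\<rho> ^ DIM('a) \<le> \<rho> powr m\<close> \<open>transversality_const R \<ge> 0\<close> assms(7)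
    by (intro mult_mono) auto
  finally show ?thesis .
next
  case False
  have "transversality_const R \<ge> 0"
    using half by (simp add: transversality_const_def)
  have "measure params (close_params R \<rho> (i # I) (j # J)) \<le> measure params (box R)"
    unfolding measure_def using assms emeasure_box
    by (intro enn2real_mono emeasure_close_params(1)[where n = "Suc n"]) auto
  also have "\<dots> = measure params (box R) * 1" by simp
  also have "\<dots> \<le> (transversality_const R + measure params (box R)) * \<rho> powr m"
    using False m(1) \<open>transversality_const R \<ge> 0\<close>
    by (intro mult_mono ge_one_powr_ge_zero) auto
  finally show ?thesis .
qed

text \<open>Pairs with different first letters are governed by transversality; pairs with first letter
  \<open>i\<close> in common reduce to words of length \<open>n\<close> at scale \<open>\<rho> / Lip i\<close>.\<close>

lemma expected_energy_Suc_le: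
  assumes "R \<ge> 0" "\<rho> > 0"
  shows "expected_energy s R (Suc n) \<rho> \<le> (transversality_const R + measure params (box R)) * \<rho> powr m
    + (\<Sum>i\<in>{1..N}. (Lip i powr s)\<^sup>2 * expected_energy s R n (\<rho> / Lip i))"
proof -
  let ?K = "(transversality_const R + measure params (box R)) * \<rho> powr m"
  let ?p = "\<lambda>i. Lip i powr s"
  let ?\<mu> = "\<lambda>I J. measure params (close_params R \<rho> I J)"
  have "?K \<ge> 0" using half by (simp add: transversality_const_def)
  define b where "b i j = (\<Sum>I\<in>words n. \<Sum>J\<in>words n. weight s I * weight s J * ?\<mu> (i # I) (j # J))" for i j
  have sum_ww: "(\<Sum>I\<in>words n. \<Sum>J\<in>words n. weight s I * weight s J * c) = c" for c
    by (simp add: sum_distrib_left[symmetric] sum_distrib_right[symmetric] sum_weight)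
  have b_le: "b i j \<le> ?K + (if i = j then expected_energy s R n (\<rho> / Lip i) else 0)"
    if ij: "i \<in> {1..N}" "j \<in> {1..N}" for i j
  proof (cases "i = j")
    case True
    then have "b i j = expected_energy s R n (\<rho> / Lip i)"
      using close_params_Cons_same[OF ij(1)] by (simp add: b_def expected_energy_def)
    then show ?thesis using True \<open>?K \<ge> 0\<close> by simp
  next
    case False
    have "b i j \<le> (\<Sum>I\<in>words n. \<Sum>J\<in>words n. weight s I * weight s J * ?K)"
      unfolding b_def using measure_close_params_le_powr[OF ij False] assms
      by (intro sum_mono mult_left_mono) (auto intro: mult_nonneg_nonneg weight_nonneg)
    also have "\<dots> = ?K" by (rule sum_ww)
    finally show ?thesis using False by simp
  qed
  have "expected_energy s R (Suc n) \<rho> = (\<Sum>i\<in>{1..N}. \<Sum>I\<in>words n. \<Sum>j\<in>{1..N}. \<Sum>J\<in>words n.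
      (?p i * weight s I) * (?p j * weight s J) * ?\<mu> (i # I) (j # J))"
    unfolding expected_energy_def sum_words_Suc by simp
  also have "\<dots> = (\<Sum>i\<in>{1..N}. \<Sum>j\<in>{1..N}. ?p i * ?p j * b i j)"
    unfolding b_def sum_distrib_left
    by (intro sum.cong refl, subst sum.swap, intro sum.cong refl) (simp add: mult_ac)
  also have "\<dots> \<le> (\<Sum>i\<in>{1..N}. \<Sum>j\<in>{1..N}. ?p i * ?p j *
      (?K + (if i = j then expected_energy s R n (\<rho> / Lip i) else 0)))"
    by (intro sum_mono mult_left_mono b_le) auto
  also have "\<dots> = (\<Sum>i\<in>{1..N}. \<Sum>j\<in>{1..N}. ?p i * ?p j * ?K) +
      (\<Sum>i\<in>{1..N}. \<Sum>j\<in>{1..N}. if i = j then ?p i * ?p j * expected_energy s R n (\<rho> / Lip i) else 0)"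
    unfolding sum.distrib[symmetric] by (intro sum.cong refl) (simp add: distrib_left)
  also have "(\<Sum>i\<in>{1..N}. \<Sum>j\<in>{1..N}. ?p i * ?p j * ?K) = ?K"
    using s by (simp add: sum_distrib_left[symmetric] sum_distrib_right[symmetric])
  also have "(\<Sum>i\<in>{1..N}. \<Sum>j\<in>{1..N}. if i = j then ?p i * ?p j * expected_energy s R n (\<rho> / Lip i) else 0)
      = (\<Sum>i\<in>{1..N}. (?p i)\<^sup>2 * expected_energy s R n (\<rho> / Lip i))"
    by (intro sum.cong refl) (simp add: power2_eq_square)
  finally show ?thesis .
qed

text \<open>In the induction the factor \<open>(Lip i)\<^bsup>-m\<^esup>\<close> from the change of scale is compensated by
  one of the two factors \<open>(Lip i)\<^bsup>s\<^esup>\<close>, since \<open>m \<le> s\<close>. The last summand accounts for the words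
  of length \<open>0\<close>.\<close>

lemma expected_energy_le:
  assumes "R \<ge> 0"
  shows "\<rho> > 0 \<Longrightarrow> expected_energy s R n \<rho> \<le>
    real n * (transversality_const R + measure params (box R)) * \<rho> powr m
    + measure params (box R) * rmax powr (real n * m)"
proof (induction n arbitrary: \<rho>)
  case 0
  have "measure params (close_params R \<rho> [] []) \<le> measure params (box R)"
    unfolding measure_def using emeasure_box
    by (intro enn2real_mono emeasure_close_params(1)[where n = 0]) auto
  then show ?case using rmax_pos by (simp add: expected_energy_def)
next
  case (Suc n)
  let ?K = "transversality_const R + measure params (box R)"
  let ?V = "measure params (box R)"
  have K: "?K \<ge> 0" using half by (simp add: transversality_const_def)
  have "(Lip i powr s)\<^sup>2 * expected_energy s R n (\<rho> / Lip i)
      \<le> Lip i powr s * (real n * ?K * \<rho> powr m + ?V * rmax powr (real (Suc n) * m))"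
    if i: "i \<in> {1..N}" for i
  proof -
    note L = Lip_pos[OF i] Lip_less_1[OF i] Lip_le_rmax[OF i]
    have "(Lip i powr s)\<^sup>2 * expected_energy s R n (\<rho> / Lip i)
      \<le> (Lip i powr s)\<^sup>2 * (real n * ?K * (\<rho> / Lip i) powr m + ?V * rmax powr (real n * m))"
      using Suc.prems L by (intro mult_left_mono Suc.IH) auto
    also have "\<dots> = Lip i powr s * (real n * ?K * (Lip i powr s * (\<rho> / Lip i) powr m)
        + ?V * (Lip i powr s * rmax powr (real n * m)))"
      by (simp add: power2_eq_square algebra_simps)
    also have "\<dots> \<le> Lip i powr s * (real n * ?K * \<rho> powr m + ?V * rmax powr (real (Suc n) * m))"
    proof (intro mult_left_mono add_mono)
      have *: "Lip i powr s \<le> Lip i powr m" using L m(2) by (intro powr_mono') auto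
      have "Lip i powr s * (\<rho> / Lip i) powr m \<le> Lip i powr m * (\<rho> / Lip i) powr m"
        using * by (intro mult_right_mono) auto
      also have "\<dots> = \<rho> powr m" using L Suc.prems by (simp add: powr_divide)
      finally show "Lip i powr s * (\<rho> / Lip i) powr m \<le> \<rho> powr m" .
      have "Lip i powr s \<le> rmax powr m"
        using * powr_mono2[OF m(1) _ L(3)] L by linarith
      then have "Lip i powr s * rmax powr (real n * m) \<le> rmax powr m * rmax powr (real n * m)"
        by (intro mult_right_mono) auto
      also have "\<dots> = rmax powr (real (Suc n) * m)"
        by (simp add: powr_add[symmetric] distrib_right)
      finally show "Lip i powr s * rmax powr (real n * m) \<le> rmax powr (real (Suc n) * m)" .
    qed (use K in auto)
    finally show ?thesis .
  qed
  then have "(\<Sum>i\<in>{1..N}. (Lip i powr s)\<^sup>2 * expected_energy s R n (\<rho> / Lip i))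
      \<le> (\<Sum>i\<in>{1..N}. Lip i powr s * (real n * ?K * \<rho> powr m + ?V * rmax powr (real (Suc n) * m)))"
    by (rule sum_mono)
  also have "\<dots> = real n * ?K * \<rho> powr m + ?V * rmax powr (real (Suc n) * m)"
    unfolding sum_distrib_right[symmetric] s by simp
  finally have "(\<Sum>i\<in>{1..N}. (Lip i powr s)\<^sup>2 * expected_energy s R n (\<rho> / Lip i))
      \<le> real n * ?K * \<rho> powr m + ?V * rmax powr (real (Suc n) * m)" .
  moreover have "?K * \<rho> powr m + real n * ?K * \<rho> powr m = real (Suc n) * ?K * \<rho> powr m"
    by (simp add: algebra_simps)
  ultimately show ?case
    using expected_energy_Suc_le[OF assms Suc.prems, of n] by linarith
qed

lemma energy_integral:
  "integrable params (\<lambda>t. indicator (box R) t * energy s n \<rho> t)"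
  "(\<integral>t. indicator (box R) t * energy s n \<rho> t \<partial>params) = expected_energy s R n \<rho>"
proof -
  have eq: "indicator (box R) t * energy s n \<rho> t = (\<Sum>I\<in>words n. \<Sum>J\<in>words n.
      weight s I * weight s J * indicator (close_params R \<rho> I J) t)" for t
    unfolding energy_def sum_distrib_left
    by (intro sum.cong refl) (auto simp: close_params_def indicator_def)
  have int: "integrable params (\<lambda>t. weight s I * weight s J * indicator (close_params R \<rho> I J) t)"
    if "I \<in> words n" "J \<in> words n" for I J
    using close_params_in_sets[OF that] emeasure_close_params(2)[OF that]
    by (intro integrable_mult_right integrable_real_indicator)
  show "integrable params (\<lambda>t. indicator (box R) t * energy s n \<rho> t)"
    unfolding eq by (intro Bochner_Integration.integrable_sum int)
  have "(\<integral>t. (\<Sum>I\<in>words n. \<Sum>J\<in>words n. weight s I * weight s J * indicator (close_params R \<rho> I J) t) \<partial>params)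
      = (\<Sum>I\<in>words n. \<integral>t. (\<Sum>J\<in>words n. weight s I * weight s J * indicator (close_params R \<rho> I J) t) \<partial>params)"
    by (intro Bochner_Integration.integral_sum Bochner_Integration.integrable_sum int)
  also have "\<dots> = (\<Sum>I\<in>words n. \<Sum>J\<in>words n.
      \<integral>t. weight s I * weight s J * indicator (close_params R \<rho> I J) t \<partial>params)"
    by (intro sum.cong refl Bochner_Integration.integral_sum int)
  also have "\<dots> = expected_energy s R n \<rho>"
    unfolding expected_energy_def
  proof (intro sum.cong refl)
    fix I J assume "I \<in> words n" "J \<in> words n"
    from sets.sets_into_space[OF close_params_in_sets[OF this]]
    show "(\<integral>t. weight s I * weight s J * indicator (close_params R \<rho> I J) t \<partial>params)
        = weight s I * weight s J * measure params (close_params R \<rho> I J)"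
      by (simp add: Int_absorb2)
  qed
  finally show "(\<integral>t. indicator (box R) t * energy s n \<rho> t \<partial>params) = expected_energy s R n \<rho>"
    unfolding eq .
qed

end

section \<open>Lower bound for almost every parameter\<close>

context similarity_ifs
begin

lemma word_map_in_attractor:
  assumes "z \<in> attractor N T t {}"
  shows "I \<in> words n \<Longrightarrow> word_map t I z \<in> attractor N T t {}"
proof (induction n arbitrary: I)
  case (Suc n)
  obtain i J where I: "i \<in> {1..N}" "J \<in> words n" "I = i # J"
    using Suc.prems by (rule words_Suc_cases)
  have "word_map t I z \<in> hutchinson t {} (attractor N T t {})"
    using I Suc.IH[OF I(2)] by auto
  then show ?case using attractor_properties(3)[OF compact_empty, of t] by (simp only:)
qed (use assms in simp)

lemma norm_word_map_diff_le:
  "I \<in> words n \<Longrightarrow> norm (word_map t I y - word_map t I z) \<le> rmax ^ n * norm (y - z)"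
proof (induction n arbitrary: I)
  case (Suc n)
  obtain i J where I: "i \<in> {1..N}" "J \<in> words n" "I = i # J"
    using Suc.prems by (rule words_Suc_cases)
  have "norm (word_map t I y - word_map t I z) = Lip i * norm (word_map t J y - word_map t J z)"
    using I dist_T[OF I(1)] by (simp add: dist_norm)
  also have "\<dots> \<le> rmax * (rmax ^ n * norm (y - z))"
    using Lip_le_rmax[OF I(1)] rmax_pos by (intro mult_mono Suc.IH[OF I(2)]) auto
  finally show ?case by (simp add: mult.assoc)
qed simp

end

context similarity_ifs_dim
begin

text \<open>The expected energy at scale \<open>R * rmax ^ n\<close> is \<open>O(n * rmax\<^bsup>n m\<^esup>)\<close>. Giving away the factor
  \<open>(n + 1)\<^sup>2\<close>, Markov's inequality yields a summable sequence of exceptional measures, to which the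
  Borel-Cantelli lemma applies.\<close>

lemma AE_energy_small:
  assumes "R > 0"
  shows "AE t in params. t \<in> box R \<longrightarrow>
    (\<forall>\<^sub>F n in sequentially. energy s n (R * rmax ^ n) t < real (n + 1) ^ 3 * rmax powr (real n * m))"
proof -
  define c where "c n = real (n + 1) ^ 3 * rmax powr (real n * m)" for n
  define u where "u n t = indicator (box R) t * energy s n (R * rmax ^ n) t" for n t
  define A where "A n = {t \<in> space params. c n \<le> u n t}" for n
  define V where "V = measure params (box R)"
  define K where "K = transversality_const R + V"
  define D where "D = K * R powr m + V"
  have "K \<ge> 0" "V \<ge> 0" using half by (simp_all add: K_def V_def transversality_const_def)
  have c: "c n > 0" for n using rmax_pos by (simp add: c_def)
  have u: "integrable params (u n)" "(\<integral>t. u n t \<partial>params) = expected_energy s R n (R * rmax ^ n)" for n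
    unfolding u_def by (rule energy_integral)+
  have A_sets: "A n \<in> sets params" for n
  proof -
    have [measurable]: "u n \<in> borel_measurable params" using u(1) by (rule borel_measurable_integrable)
    show ?thesis unfolding A_def by measurable
  qed
  have A_finite: "emeasure params (A n) < \<infinity>" for n
  proof -
    have "A n \<subseteq> box R"
      using c[of n] by (auto simp: A_def u_def indicator_def split: if_splits)
    then have "emeasure params (A n) \<le> emeasure params (box R)" by (rule emeasure_mono[OF _ box_in_sets])
    then show ?thesis using emeasure_box by (rule le_less_trans)
  qed
  have A_le: "measure params (A n) \<le> D * inverse (real (Suc n) ^ 2)" for n
  proof -
    have "0 \<le> u n t" for t
      unfolding u_def energy_def by (intro mult_nonneg_nonneg sum_nonneg weight_nonneg) auto
    then have "measure params (A n) \<le> (\<integral>t. u n t \<partial>params) / c n"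
      unfolding A_def by (intro integral_Markov_inequality_measure[OF u(1) box_in_sets] c) auto
    also have "\<dots> \<le> (real (n + 1) * D * rmax powr (real n * m)) / c n"
    proof (rule divide_right_mono)
      have scale: "(R * rmax ^ n) powr m = R powr m * rmax powr (real n * m)"
        using rmax_pos assms by (simp add: powr_mult powr_powr powr_realpow[symmetric])
      have "expected_energy s R n (R * rmax ^ n)
          \<le> real n * K * (R * rmax ^ n) powr m + V * rmax powr (real n * m)"
        using assms rmax_pos unfolding K_def V_def by (intro expected_energy_le) auto
      also have "\<dots> = (real n * (K * R powr m) + 1 * V) * rmax powr (real n * m)"
        unfolding scale by (simp add: algebra_simps)
      also have "\<dots> \<le> (real (n + 1) * (K * R powr m) + real (n + 1) * V) * rmax powr (real n * m)"
        using \<open>K \<ge> 0\<close> \<open>V \<ge> 0\<close> by (intro mult_right_mono add_mono) auto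
      also have "\<dots> = real (n + 1) * D * rmax powr (real n * m)"
        by (simp add: D_def distrib_left)
      finally show "(\<integral>t. u n t \<partial>params) \<le> real (n + 1) * D * rmax powr (real n * m)"
        unfolding u(2) .
    qed (use c in \<open>simp add: less_imp_le\<close>)
    also have "\<dots> = D * inverse (real (Suc n) ^ 2)"
    proof -
      have cancel: "a * D * w / (a ^ 3 * w) = D * inverse (a ^ 2)" if "a > 0" "w > 0" for a w :: real
        using that by (simp add: power3_eq_cube power2_eq_square divide_simps)
      have "real (n + 1) > 0" "rmax powr (real n * m) > 0" using rmax_pos by simp_all
      then show ?thesis unfolding c_def Suc_eq_plus1 by (rule cancel)
    qed
    finally show ?thesis .
  qed
  have "summable (\<lambda>n. D * inverse (real (Suc n) ^ 2))"
    using inverse_power_summable[of 2, where 'a = real]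
    by (intro summable_mult) (subst summable_Suc_iff[of "\<lambda>n. inverse (real n ^ 2)"], simp)
  then have "summable (\<lambda>n. measure params (A n))"
    by (rule summable_comparison_test'[where N = 0]) (use A_le in simp)
  from borel_cantelli_AE1[OF A_sets A_finite this]
  show ?thesis
  proof eventually_elim
    case (elim t)
    show ?case
    proof
      assume "t \<in> box R"
      show "\<forall>\<^sub>F n in sequentially. energy s n (R * rmax ^ n) t < real (n + 1) ^ 3 * rmax powr (real n * m)"
        using elim by eventually_elim (use \<open>t \<in> box R\<close> in \<open>auto simp: A_def u_def c_def\<close>)
    qed
  qed
qed

text \<open>If the unit mass carried by the words is distributed over \<open>k\<close> sets, then by the
  Cauchy-Schwarz inequality pairs of words in a common set have total weight at least \<open>1 / k\<close>; and
  the points of two such words are close. The points used lie in the attractor, whereas the energy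
  is defined with base point \<open>0\<close>; this costs the term \<open>2 * norm z\<close>.\<close>

lemma one_le_covering_number_mult_energy:
  assumes z: "z \<in> attractor N T t {}" and R: "1 + 2 * norm z \<le> R"
  shows "1 \<le> real (covering_number (rmax ^ n) (attractor N T t {})) * energy s n (R * rmax ^ n) t"
proof -
  define \<delta> where "\<delta> = rmax ^ n"
  have "\<delta> > 0" using rmax_pos by (simp add: \<delta>_def)
  obtain \<U> where U: "covers \<delta> (attractor N T t {}) \<U>"
      "card \<U> = covering_number \<delta> (attractor N T t {})"
    using covering_number_attained \<open>\<delta> > 0\<close> attractor_properties(2) compact_imp_bounded compact_empty
    by metis
  have "\<forall>I\<in>words n. \<exists>U\<in>\<U>. word_map t I z \<in> U"
    using U(1) word_map_in_attractor[OF z] unfolding covers_def by blast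
  then obtain \<phi> where \<phi>: "\<And>I. I \<in> words n \<Longrightarrow> \<phi> I \<in> \<U> \<and> word_map t I z \<in> \<phi> I"
    by metis
  have close: "norm (word_map t I 0 - word_map t J 0) \<le> R * \<delta>"
    if I: "I \<in> words n" and J: "J \<in> words n" and eq: "\<phi> I = \<phi> J" for I J
  proof -
    have "bounded (\<phi> I)" "diameter (\<phi> I) \<le> \<delta>" using \<phi>[OF I] U(1) by (auto simp: covers_def)
    moreover have "word_map t I z \<in> \<phi> I" "word_map t J z \<in> \<phi> I" using \<phi> I J eq by auto
    ultimately have "norm (word_map t I z - word_map t J z) \<le> \<delta>"
      using diameter_bounded_bound[of "\<phi> I" "word_map t I z" "word_map t J z"] by (simp add: dist_norm)
    moreover have "norm (word_map t I 0 - word_map t I z) \<le> \<delta> * norm z"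
      "norm (word_map t J z - word_map t J 0) \<le> \<delta> * norm z"
      using norm_word_map_diff_le[OF I, of t 0 z] norm_word_map_diff_le[OF J, of t z 0]
      by (simp_all add: \<delta>_def)
    moreover have "norm (word_map t I 0 - word_map t J 0) \<le> norm (word_map t I 0 - word_map t I z)
        + norm (word_map t I z - word_map t J z) + norm (word_map t J z - word_map t J 0)"
      by norm
    moreover have "(1 + 2 * norm z) * \<delta> \<le> R * \<delta>"
      using R \<open>\<delta> > 0\<close> by (intro mult_right_mono) auto
    ultimately show ?thesis by (simp add: algebra_simps)
  qed
  define P where "P U = (\<Sum>I\<in>{I \<in> words n. \<phi> I = U}. weight s I)" for U
  have fin: "finite \<U>" using U(1) by (simp add: covers_def)
  have sub: "\<phi> ` words n \<subseteq> \<U>" using \<phi> by auto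
  have "(\<Sum>U\<in>\<U>. P U) = 1"
    unfolding P_def using sum.group[OF finite_words fin sub, of "weight s"] sum_weight by simp
  then have "1 = (\<Sum>U\<in>\<U>. P U)\<^sup>2" by simp
  also have "\<dots> \<le> (\<Sum>U\<in>\<U>. (P U)\<^sup>2) * card \<U>"
    by (rule sum_squared_le_sum_of_squares)
  also have "(\<Sum>U\<in>\<U>. (P U)\<^sup>2) = (\<Sum>U\<in>\<U>. \<Sum>I\<in>{I \<in> words n. \<phi> I = U}. weight s I * P (\<phi> I))"
  proof (rule sum.cong[OF refl])
    fix U
    have "(P U)\<^sup>2 = (\<Sum>I\<in>{I \<in> words n. \<phi> I = U}. weight s I * P U)"
      by (simp add: power2_eq_square P_def sum_distrib_right)
    also have "\<dots> = (\<Sum>I\<in>{I \<in> words n. \<phi> I = U}. weight s I * P (\<phi> I))"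
      by (intro sum.cong) auto
    finally show "(P U)\<^sup>2 = (\<Sum>I\<in>{I \<in> words n. \<phi> I = U}. weight s I * P (\<phi> I))" .
  qed
  also have "\<dots> = (\<Sum>I\<in>words n. weight s I * P (\<phi> I))"
    by (rule sum.group[OF finite_words fin sub])
  also have "\<dots> \<le> energy s n (R * \<delta>) t"
    unfolding energy_def
  proof (rule sum_mono)
    fix I assume I: "I \<in> words n"
    have "weight s I * P (\<phi> I) = (\<Sum>J\<in>{J \<in> words n. \<phi> J = \<phi> I}. weight s I * weight s J *
        of_bool (norm (word_map t I 0 - word_map t J 0) \<le> R * \<delta>))"
      unfolding P_def sum_distrib_left using close[OF I] by (intro sum.cong) auto
    also have "\<dots> \<le> (\<Sum>J\<in>words n. weight s I * weight s J *
        of_bool (norm (word_map t I 0 - word_map t J 0) \<le> R * \<delta>))"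
      by (intro sum_mono2 finite_words) (auto simp: weight_nonneg)
    finally show "weight s I * P (\<phi> I) \<le> \<dots>" .
  qed
  finally show ?thesis by (simp add: U(2) \<delta>_def mult.commute mult_left_mono mult_right_mono)
qed

lemma le_upper_box_dim_attractor:
  assumes z: "z \<in> attractor N T t {}" and R: "1 + 2 * norm z \<le> R"
    and small: "\<forall>\<^sub>F n in sequentially.
      energy s n (R * rmax ^ n) t < real (n + 1) ^ 3 * rmax powr (real n * m)"
  shows "ereal m \<le> upper_box_dim (attractor N T t {})"
proof -
  define L where "L = - ln rmax"
  have "L > 0" using rmax_pos rmax_less_1 by (simp add: L_def)
  show ?thesis
  proof (rule le_upper_box_dimI)
    show "rmax ^ n > 0" for n using rmax_pos by simp
    show "(\<lambda>n. rmax ^ n) \<longlonglongrightarrow> 0" using rmax_pos rmax_less_1 by (intro LIMSEQ_realpow_zero) auto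
    show "(\<lambda>n. m - 3 * ln (real n + 1) / (real n * L)) \<longlonglongrightarrow> m"
      using \<open>L > 0\<close> by real_asymp
    show "\<forall>\<^sub>F n in sequentially. m - 3 * ln (real n + 1) / (real n * L)
        \<le> ln (real (covering_number (rmax ^ n) (attractor N T t {}))) / - ln (rmax ^ n)"
      using small eventually_gt_at_top[of 0]
    proof eventually_elim
      case (elim n)
      define k where "k = real (covering_number (rmax ^ n) (attractor N T t {}))"
      define c where "c = real (n + 1) ^ 3 * rmax powr (real n * m)"
      have "1 \<le> k * energy s n (R * rmax ^ n) t"
        unfolding k_def by (rule one_le_covering_number_mult_energy[OF z R])
      also have "\<dots> \<le> k * c"
        using elim by (intro mult_left_mono) (auto simp: c_def k_def)
      finally have "1 \<le> k * c" .
      have "c > 0" using rmax_pos by (simp add: c_def)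
      have "k > 0" using \<open>1 \<le> k * c\<close> \<open>c > 0\<close> by (metis less_le_trans zero_less_mult_pos2 zero_less_one)
      have "0 \<le> ln (k * c)" using \<open>1 \<le> k * c\<close> by simp
      also have "\<dots> = ln k + ln c" using \<open>k > 0\<close> \<open>c > 0\<close> by (simp add: ln_mult)
      also have "ln c = 3 * ln (real n + 1) - real n * m * L"
        using rmax_pos unfolding c_def by (subst ln_mult) (auto simp: ln_realpow ln_powr L_def add.commute)
      finally have "real n * m * L - 3 * ln (real n + 1) \<le> ln k" by simp
      then have "(real n * m * L - 3 * ln (real n + 1)) / (real n * L) \<le> ln k / (real n * L)"
        using \<open>L > 0\<close> by (intro divide_right_mono) auto
      moreover have "(real n * m * L - 3 * ln (real n + 1)) / (real n * L)
          = m - 3 * ln (real n + 1) / (real n * L)"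
        using \<open>L > 0\<close> elim by (simp add: diff_divide_distrib)
      moreover have "- ln (rmax ^ n) = real n * L"
        using rmax_pos by (simp add: ln_realpow L_def)
      ultimately show ?case by (simp add: k_def)
    qed
  qed
qed

lemma AE_le_upper_box_dim_attractor:
  "AE t in params. ereal m \<le> upper_box_dim (attractor N T t {})"
proof -
  have "AE t in params. \<forall>R::nat. t \<in> box (real (Suc R)) \<longrightarrow> (\<forall>\<^sub>F n in sequentially.
      energy s n (real (Suc R) * rmax ^ n) t < real (n + 1) ^ 3 * rmax powr (real n * m))"
    by (intro AE_all_countable[THEN iffD2] allI AE_energy_small) simp
  then show ?thesis
    using AE_space
  proof eventually_elim
    case (elim t)
    obtain z where z: "z \<in> attractor N T t {}" using attractor_properties(1)[OF compact_empty, of t] by blast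
    define A where "A = (\<Sum>i\<in>{1..N}. norm (t i))"
    obtain R :: nat where R: "1 + 2 * norm z + A \<le> real R" using real_arch_simple by blast
    have "A \<ge> 0" by (simp add: A_def sum_nonneg)
    have "norm (t i) \<le> real (Suc R)" if "i \<in> {1..N}" for i
    proof -
      have "norm (t i) \<le> A" unfolding A_def using that by (intro member_le_sum) auto
      then show ?thesis using R norm_ge_zero[of z] unfolding of_nat_Suc by linarith
    qed
    then have "t \<in> box (real (Suc R))"
      using elim(2) by (auto simp: box_def space_PiM PiE_def)
    then show ?case
      using elim(1) R \<open>A \<ge> 0\<close> by (intro le_upper_box_dim_attractor[OF z, of "real (Suc R)"]) auto
  qed
qed

end

section \<open>The dimension of the inhomogeneous attractor\<close>

theorem corollary2p3:
  fixes T :: "nat \<Rightarrow> real ^ 'd \<Rightarrow> real ^ 'd"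
    and Lip :: "nat \<Rightarrow> real"
    and N :: nat
    and C :: "(real ^ 'd) set"
  assumes "N \<ge> 1"
    and "\<And>i. i \<in> {1..N} \<Longrightarrow> linear_contracting_similarity (T i) (Lip i)"
    and "\<And>i. i \<in> {1..N} \<Longrightarrow> Lip i < 1 / 2"
    and "C \<noteq> {}" and "compact C"
  shows "AE t in (\<Pi>\<^sub>M i\<in>{1..N}. lborel).
    upper_box_dim (attractor N T t C) =
      max (upper_box_dim (attractor N T t {})) (upper_box_dim C)"
proof -
  interpret similarity_ifs T Lip N
    using assms(1,2) by unfold_locales
  obtain s where dim: "0 \<le> s" "(\<Sum>i\<in>{1..N}. Lip i powr s) = 1"
    by (rule similarity_dimension_exists)
  define m where "m = min s (real DIM(real ^ 'd))"
  obtain i where "i \<in> {1..N}" "rmax = Lip i" by (rule rmax_attained)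
  then have "rmax < 1 / 2" using assms(3) by simp
  then interpret similarity_ifs_dim T Lip N s m
    using dim by unfold_locales (auto simp: m_def)
  show ?thesis
    using AE_le_upper_box_dim_attractor
  proof eventually_elim
    case (elim t)
    let ?F = "attractor N T t C" and ?H = "attractor N T t {}"
    have F: "?F \<noteq> {}" "bounded ?F"
      by (rule attractor_properties(1)[OF assms(5)])
        (rule compact_imp_bounded[OF attractor_properties(2)[OF assms(5)]])
    show ?case
    proof (rule antisym)
      show "max (upper_box_dim ?H) (upper_box_dim C) \<le> upper_box_dim ?F"
        using upper_box_dim_mono[OF F(2) attractor_empty_subset[OF assms(5)]
            attractor_properties(1)[OF compact_empty]]
          upper_box_dim_mono[OF F(2) condensation_subset_attractor[OF assms(5)] assms(4)]
        by (rule max.boundedI)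
      show "upper_box_dim ?F \<le> max (upper_box_dim ?H) (upper_box_dim C)"
      proof (cases "s \<le> real DIM(real ^ 'd)")
        case True
        have "ereal s \<le> upper_box_dim ?H" using True elim by (simp add: m_def)
        show ?thesis
          by (rule order_trans[OF upper_box_dim_attractor_le[OF assms(5,4) dim(2)] max.mono])
            (rule \<open>ereal s \<le> upper_box_dim ?H\<close>, rule order_refl)
      next
        case False
        then have "m = real DIM(real ^ 'd)" by (simp add: m_def)
        with elim have "ereal (real DIM(real ^ 'd)) \<le> upper_box_dim ?H" by simp
        from order_trans[OF upper_box_dim_le_DIM[OF F(2,1)] this] show ?thesis
          by (rule max.coboundedI1)
      qed
    qed
  qed
qed

end
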